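(* For generic $a\in\mathbb{C}^*$ (so that all terms are defined), $$\sum_{n=0}^{\infty}q^{2n+1}(-aq;q^2)_n(-q/a;q^2)_n=-q\,g(-aq,q^2)+a\frac{j(-aq;q^2)}{J_2}\,m(a^2,q^2,-1)-\frac12\frac{a\,j(aq;q^2)^3\,j(a^2;q^4)}{J_4^2\,j(a^4;q^4)}$$ $$=-q\,g(-aq,q^2)+a\frac{j(-aq;q^2)}{J_2}\,m(a^2,q^2,-a^{-1}q).$$
   Context: $q$ is a complex number with $0<|q|<1$. $(x;q)_n=\prod_{i=0}^{n-1}(1-xq^i)$, $(x;q)_\infty=\prod_{i\ge0}(1-xq^i)$, $j(x;q)=(x;q)_\infty(q/x;q)_\infty(q;q)_\infty$, and $J_m=(q^m;q^m)_\infty$. The Appell--Lerch sum is $m(x,q,z)=\frac{1}{j(z;q)}\sum_{r\in\mathbb{Z}}\frac{(-1)^rq^{\binom r2}z^r}{1-q^{r-1}xz}$, and the universal mock theta function is $g(x,q)=x^{-1}\big(-1+\sum_{n=0}^{\infty}\frac{q^{n^2}}{(x;q)_{n+1}(q/x;q)_n}\big)$ (so $g(x,q^2)$ is this with $q$ replaced by $q^2$). *)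

theory Defs
  imports "HOL-Analysis.Analysis"
begin

definition qpoch :: "complex \<Rightarrow> complex \<Rightarrow> nat \<Rightarrow> complex" where
  "qpoch x q n = (\<Prod>i<n. 1 - x * q ^ i)"

text \<open>For |q| < 1 the product below converges in the sense of \<^const>\<open>has_prod\<close>, which allows
  finitely many vanishing factors (the value then being 0).\<close>

definition qpoch_inf :: "complex \<Rightarrow> complex \<Rightarrow> complex" where
  "qpoch_inf x q = (\<Prod>i. 1 - x * q ^ i)"

definition jtheta :: "complex \<Rightarrow> complex \<Rightarrow> complex" where
  "jtheta x q = qpoch_inf x q * qpoch_inf (q / x) q * qpoch_inf q q"

definition J :: "complex \<Rightarrow> nat \<Rightarrow> complex" where
  "J q m = qpoch_inf (q ^ m) (q ^ m)"

text \<open>The exponent \<open>r (r - 1) div 2\<close> is the binomial coefficient of r over 2 for integer r;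
  the division is exact.\<close>

definition appell_m :: "complex \<Rightarrow> complex \<Rightarrow> complex \<Rightarrow> complex" where
  "appell_m x q z =
     1 / jtheta z q *
     (\<Sum>\<^sub>\<infinity>r::int. (-1) powi r * q powi (r * (r - 1) div 2) * z powi r
                     / (1 - q powi (r - 1) * x * z))"

definition mock_g :: "complex \<Rightarrow> complex \<Rightarrow> complex" where
  "mock_g x q =
     1 / x * (- 1 + (\<Sum>n. q ^ (n\<^sup>2) / (qpoch x q (n + 1) * qpoch (q / x) q n)))"

text \<open>Since division by zero yields 0 in HOL, the following predicates record that no denominator
  in the corresponding expression vanishes (for 0 < |q| < 1).\<close>

definition appell_m_defined :: "complex \<Rightarrow> complex \<Rightarrow> complex \<Rightarrow> bool" where
  "appell_m_defined x q z \<longleftrightarrow>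
     z \<noteq> 0 \<and> jtheta z q \<noteq> 0 \<and> (\<forall>r::int. 1 - q powi (r - 1) * x * z \<noteq> 0)"

definition mock_g_defined :: "complex \<Rightarrow> complex \<Rightarrow> bool" where
  "mock_g_defined x q \<longleftrightarrow>
     x \<noteq> 0 \<and> (\<forall>n. qpoch x q (n + 1) * qpoch (q / x) q n \<noteq> 0)"

end

theory Submission
  imports Defs "HOL-Complex_Analysis.Complex_Analysis"
begin

text \<open>Replace \<open>q\<^sup>2\<close> by \<open>q\<close> and put \<open>x = - a q\<close>. The series on the left, \<open>F(x)\<close>, and \<open>g(x)\<close> satisfy
  \<open>F(q x) + x\<^sup>3 F(x) = (1 - x\<^sup>2) (x;q)\<^bsub>\<infinity>\<^esub> (q/x;q)\<^bsub>\<infinity>\<^esub> + x + x\<^sup>2\<close> and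
  \<open>g(q x) + x\<^sup>3 g(x) = - x - x\<^sup>2\<close>. By the Jacobi triple product the Appell--Lerch sum of the second
  equation satisfies the equation of \<open>F + g\<close>, so the difference \<open>D\<close> of the two sides, multiplied by
  \<open>j(x)\<close> to remove the poles, gives a function \<open>E\<close> that is holomorphic on the punctured plane with
  \<open>E(q x) = x\<^sup>2 E(x)\<close>. Such a function is bounded near \<open>0\<close> and near \<open>\<infinity>\<close>, hence constant by Liouville's
  theorem, hence zero. The same principle, applied in the variable \<open>x\<close>, shows how \<open>m(x,q,z)\<close> depends on \<open>z\<close>;
  the theta quotient in the first equation is this change of \<open>z\<close> after product identities.\<close>

section \<open>The Jacobi triple product\<close>

text \<open>The exponents decide what can be concluded. Quasi-periodicity
  \<open>f(q x) = c x^k f(x)\<close> forces \<open>f = 0\<close> only for \<open>k > 0\<close>; a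
  theta function has \<open>k = -1\<close>. The difference \<open>D\<close> satisfies
  \<open>D(q x) = -x^3 D(x)\<close>, and the factor \<open>j(x)\<close> costs one power, which
  leaves 2. In the change of \<open>z\<close>, the difference with cleared denominators has exponent
  -1, just as \<open>j(z0 z1 x)\<close> has. Only division by two theta functions raises it to 1;
  for this their zeros must be zeros of the numerator, and that condition fixes the constant in the
  formula.

  The value \<open>z = -q/a\<close> is the natural one: in base \<open>q^2\<close> it is
  \<open>q^2/x\<close>, with \<open>a^2 z = x\<close> and \<open>z^2 a^2 = q^2\<close>. These
  products are the arguments of the pole-free form of the Appell--Lerch sum; the second is constant,
  so the sum obeys an equation in \<open>x\<close> alone. Hence the equation with
  \<open>z = -q/a\<close> comes first and the one with \<open>z = -1\<close> is deduced from it.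

  The equations of \<open>F\<close> and \<open>g\<close> are derived only where no denominator
  vanishes; pole-free forms and analytic continuation cover the other points.\<close>

locale nome =
  fixes q :: complex
  assumes q_nz [simp]: "q \<noteq> 0" and q_lt_1: "norm q < 1"
begin

section \<open>Finite and infinite q-shifted factorials\<close>

lemma qpoch_0 [simp]: "qpoch x q 0 = 1"
  by (simp add: qpoch_def)

lemma qpoch_Suc: "qpoch x q (Suc n) = qpoch x q n * (1 - x * q ^ n)"
  by (simp add: qpoch_def)

lemma qpoch_Suc_shift: "qpoch x q (Suc n) = (1 - x) * qpoch (x * q) q n"
  unfolding qpoch_def by (subst prod.lessThan_Suc_shift) (simp add: mult_ac)

lemma convergent_prod_qpoch: "convergent_prod (\<lambda>i. 1 - x * q ^ i)"
proof -
  have "summable (\<lambda>i. norm ((1 - x * q ^ i) - 1))"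
    using q_lt_1 by (auto simp: norm_mult norm_power intro!: summable_mult summable_geometric)
  hence "abs_convergent_prod (\<lambda>i. 1 - x * q ^ i)"
    by (subst abs_convergent_prod_conv_summable)
  thus ?thesis
    by (rule abs_convergent_prod_imp_convergent_prod)
qed

lemma qpoch_tendsto: "(\<lambda>n. qpoch x q n) \<longlonglongrightarrow> qpoch_inf x q"
  using convergent_prod_LIMSEQ[OF convergent_prod_qpoch[of x]]
    LIMSEQ_lessThan_iff_atMost[where f = "prod (\<lambda>i. 1 - x * q ^ i)"]
  unfolding qpoch_def qpoch_inf_def by blast

lemma qpoch_inf_shift: "qpoch_inf x q = (1 - x) * qpoch_inf (x * q) q"
proof (rule LIMSEQ_unique)
  show "(\<lambda>n. qpoch x q (Suc n)) \<longlonglongrightarrow> qpoch_inf x q"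
    by (rule LIMSEQ_Suc, rule qpoch_tendsto)
  show "(\<lambda>n. qpoch x q (Suc n)) \<longlonglongrightarrow> (1 - x) * qpoch_inf (x * q) q"
    unfolding qpoch_Suc_shift by (intro tendsto_intros qpoch_tendsto)
qed

lemma qpoch_inf_split: "qpoch_inf x q = qpoch x q n * qpoch_inf (x * q ^ n) q"
proof (induction n)
  case (Suc n)
  also have "qpoch_inf (x * q ^ n) q = (1 - x * q ^ n) * qpoch_inf (x * q ^ Suc n) q"
    by (subst qpoch_inf_shift) (simp add: mult_ac)
  finally show ?case
    by (simp add: qpoch_Suc)
qed simp

text \<open>\<open>1 + t <= exp t\<close> turns the product into a geometric sum. Being uniform in
  \<open>n\<close>, the bound passes to the infinite product and feeds the majorants of the later
  series.\<close>

lemma norm_qpoch_le: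
  assumes "norm x \<le> R"
  shows "norm (qpoch x q n) \<le> exp (R / (1 - norm q))"
proof -
  have R: "R \<ge> 0"
    using assms norm_ge_zero order_trans by blast
  have "norm (qpoch x q n) \<le> (\<Prod>i<n. 1 + R * norm q ^ i)"
    unfolding qpoch_def prod_norm [symmetric]
  proof (intro prod_mono conjI norm_ge_zero)
    fix i
    have "norm (1 - x * q ^ i) \<le> 1 + norm (x * q ^ i)"
      by (metis norm_one norm_triangle_ineq4)
    also have "\<dots> \<le> 1 + R * norm q ^ i"
      using assms by (auto simp: norm_mult norm_power intro!: mult_right_mono)
    finally show "norm (1 - x * q ^ i) \<le> 1 + R * norm q ^ i" .
  qed
  also have "\<dots> \<le> exp (\<Sum>i<n. R * norm q ^ i)"
    using R by (intro prod_le_exp_sum) auto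
  also have "(\<Sum>i<n. R * norm q ^ i) \<le> (\<Sum>i. R * norm q ^ i)"
    using R q_lt_1 by (intro sum_le_suminf summable_mult summable_geometric) auto
  also have "\<dots> = R / (1 - norm q)"
    using q_lt_1 by (subst suminf_mult) (auto simp: suminf_geometric intro!: summable_geometric)
  finally show ?thesis by simp
qed

lemma norm_qpoch_inf_le:
  assumes "norm x \<le> R"
  shows "norm (qpoch_inf x q) \<le> exp (R / (1 - norm q))"
  using tendsto_norm[OF qpoch_tendsto[of x]]
  by (rule LIMSEQ_le_const2) (use norm_qpoch_le[OF assms] in auto)

text \<open>A product convergent in the sense of \<open>has_prod\<close> is 0 only through a
  vanishing factor.\<close>

lemma qpoch_inf_eq_0_iff: "qpoch_inf x q = 0 \<longleftrightarrow> (\<exists>n. x * q ^ n = 1)"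
proof
  assume "\<exists>n. x * q ^ n = 1"
  then obtain n where "x * q ^ n = 1" by blast
  thus "qpoch_inf x q = 0"
    using qpoch_inf_split[of x "Suc n"] by (simp add: qpoch_Suc)
next
  assume *: "qpoch_inf x q = 0"
  hence "(\<lambda>i. 1 - x * q ^ i) has_prod 0"
    using convergent_prod_qpoch by (simp add: has_prod_iff qpoch_inf_def)
  hence "\<exists>i. 1 - x * q ^ i = 0"
    by (metis (no_types, lifting) has_prod_eq_0_iff rangeE)
  thus "\<exists>n. x * q ^ n = 1" by auto
qed

lemma power_q_neq_1: "n > 0 \<Longrightarrow> q ^ n \<noteq> 1"
  using q_lt_1 by (metis norm_one norm_power power_Suc_less_one norm_ge_zero power_less_one_iff less_irrefl)

lemma qpoch_inf_q_nz [simp]: "qpoch_inf q q \<noteq> 0"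
  using power_q_neq_1[of "Suc _"] by (auto simp: qpoch_inf_eq_0_iff)

lemma qpoch_inf_1 [simp]: "qpoch_inf 1 q = 0"
  by (subst qpoch_inf_shift) simp

lemma qpoch_holomorphic: "(\<lambda>x. qpoch x q n) holomorphic_on A"
  unfolding qpoch_def by (intro holomorphic_intros)

lemma qpoch_inf_holomorphic': "(\<lambda>x. qpoch_inf x q) holomorphic_on UNIV"
proof (rule holomorphic_uniform_sequence[where f = "\<lambda>n x. qpoch x q n"])
  fix x :: complex
  define A where "A = cball x 1"
  define R where "R = norm x + 1"
  have R: "norm y \<le> R" if "y \<in> A" for y
    using that unfolding A_def R_def dist_norm mem_cball
    by (smt (verit) norm_triangle_ineq2 norm_minus_commute)
  have "uniformly_convergent_on A (\<lambda>N x. \<Prod>n<N. 1 - x * q ^ n)"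
  proof (rule uniformly_convergent_on_prod')
    show "compact A" by (simp add: A_def)
    show "uniformly_convergent_on A (\<lambda>N x. \<Sum>n<N. norm (1 - x * q ^ n - 1))"
      using R q_lt_1
      by (intro Weierstrass_m_test'[where M = "\<lambda>n. R * norm q ^ n"])
         (auto simp: norm_mult norm_power intro!: mult_right_mono summable_mult summable_geometric)
  qed (auto intro!: continuous_intros)
  then obtain l where l: "uniform_limit A (\<lambda>n x. qpoch x q n) l sequentially"
    unfolding uniformly_convergent_on_def qpoch_def by blast
  have "l y = qpoch_inf y q" if "y \<in> A" for y
    using tendsto_uniform_limitI[OF l that] qpoch_tendsto LIMSEQ_unique by blast
  hence "uniform_limit A (\<lambda>n x. qpoch x q n) (\<lambda>x. qpoch_inf x q) sequentially"
    using l uniform_limit_cong' by (metis (no_types, lifting))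
  thus "\<exists>d>0. cball x d \<subseteq> UNIV \<and>
          uniform_limit (cball x d) (\<lambda>n x. qpoch x q n) (\<lambda>x. qpoch_inf x q) sequentially"
    unfolding A_def by (intro exI[of _ 1]) auto
qed (auto intro: qpoch_holomorphic)

lemma qpoch_inf_holomorphic [holomorphic_intros]:
  assumes "f holomorphic_on A"
  shows "(\<lambda>x. qpoch_inf (f x) q) holomorphic_on A"
  using holomorphic_on_compose_gen[OF assms qpoch_inf_holomorphic'] by (auto simp: o_def)

end

section \<open>Quadratic exponents and sums over the integers\<close>

lemma summable_gauss:
  fixes r K :: real
  assumes "0 \<le> r" "r < 1"
  shows "summable (\<lambda>n. r ^ (n * (n + 1) div 2) * K ^ n)"
proof -
  \<comment> \<open>In absolute value this is the ratio of consecutive terms; it tends to 0 whatever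
    the size of \<open>K\<close>.\<close>
  have "(\<lambda>n. r ^ Suc n * \<bar>K\<bar>) \<longlonglongrightarrow> 0"
    using LIMSEQ_Suc[OF LIMSEQ_power_zero[of r]] assms by (intro tendsto_mult_left_zero) auto
  hence "eventually (\<lambda>n. r ^ Suc n * \<bar>K\<bar> < 1 / 2) sequentially"
    by (rule order_tendstoD) auto
  then obtain N where N: "\<And>n. n \<ge> N \<Longrightarrow> r ^ Suc n * \<bar>K\<bar> < 1 / 2"
    unfolding eventually_sequentially by blast
  show ?thesis
  proof (rule summable_ratio_test)
    fix n assume "n \<ge> N"
    have "Suc n * (Suc n + 1) div 2 = n * (n + 1) div 2 + Suc n"
      by simp
    hence "norm (r ^ (Suc n * (Suc n + 1) div 2) * K ^ Suc n) =
             (r ^ Suc n * \<bar>K\<bar>) * norm (r ^ (n * (n + 1) div 2) * K ^ n)"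
      using assms by (simp only: power_add) (simp add: abs_mult power_abs mult_ac)
    also have "\<dots> \<le> 1 / 2 * norm (r ^ (n * (n + 1) div 2) * K ^ n)"
      using N[OF \<open>n \<ge> N\<close>] by (intro mult_right_mono) auto
    finally show "norm (r ^ (Suc n * (Suc n + 1) div 2) * K ^ Suc n) \<le>
                    1 / 2 * norm (r ^ (n * (n + 1) div 2) * K ^ n)" .
  qed simp
qed

text \<open>Each half of the integers is a copy of part of the naturals, so a majorant depending
  only on the absolute value of the index reduces a two-sided sum to a series.\<close>

lemma summable_on_int_abs:
  fixes f :: "nat \<Rightarrow> real"
  assumes "summable f" "\<And>n. f n \<ge> 0"
  shows "(\<lambda>s::int. f (nat \<bar>s\<bar>)) summable_on UNIV"
proof -
  have f: "f summable_on UNIV"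
    using assms by (simp add: summable_on_UNIV_nonneg_real_iff)
  have 1: "(\<lambda>s. f (nat \<bar>s\<bar>)) summable_on {0..}"
    using f by (subst summable_on_reindex_bij_witness[of _ int nat UNIV f]) auto
  have "f summable_on {1..}"
    using f by (rule summable_on_subset_banach) auto
  hence 2: "(\<lambda>s. f (nat \<bar>s\<bar>)) summable_on {..<0}"
    by (subst summable_on_reindex_bij_witness[of _ "\<lambda>n. - int n" "\<lambda>s. nat (-s)" "{1..}" f]) auto
  have "{0..} \<union> {..<0} = (UNIV :: int set)" "{0..} \<inter> {..<0::int} = {}" by auto
  thus ?thesis
    using summable_on_Un_disjoint[OF 1 2] by auto
qed

text \<open>The exponent in \<open>appell_m\<close>. With \<open>two_tri\<close> and
  \<open>tri_add_1\<close>, exponents can be compared without \<open>div\<close>.\<close>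

definition tri :: "int \<Rightarrow> int" where "tri k = k * (k - 1) div 2"

lemma two_tri: "2 * tri k = k * (k - 1)"
  unfolding tri_def by (rule dvd_mult_div_cancel) simp

lemma tri_add_1: "tri (k + 1) = tri k + k"
proof -
  have "2 * tri (k + 1) = 2 * (tri k + k)"
    unfolding distrib_left two_tri by (simp add: algebra_simps)
  thus ?thesis by simp
qed

lemma tri_of_nat: "tri (int n) = int (n * (n - 1) div 2)"
  by (cases n) (simp_all add: tri_def zdiv_int algebra_simps)

lemma tri_minus_of_nat: "tri (- int n) = int (n * (n + 1) div 2)"
  by (simp add: tri_def zdiv_int algebra_simps)

lemma tri_0 [simp]: "tri 0 = 0" by (simp add: tri_def)

context nome
begin

section \<open>Quasi-periodicity and zeros of the theta function\<close>

lemma jtheta_q_mult: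
  assumes "x \<noteq> 0"
  shows "jtheta (q * x) q = - jtheta x q / x"
proof -
  \<comment> \<open>Passing from \<open>x\<close> to \<open>q x\<close> trades the factor
    \<open>1 - x\<close> of the first product for \<open>1 - 1/x\<close> in the second.\<close>
  have "jtheta x q = (1 - x) * qpoch_inf (q * x) q * qpoch_inf (q / x) q * qpoch_inf q q"
    unfolding jtheta_def by (subst qpoch_inf_shift[of x]) (simp add: mult_ac)
  moreover have "jtheta (q * x) q =
                   (1 - 1 / x) * qpoch_inf (q * x) q * qpoch_inf (q / x) q * qpoch_inf q q"
    unfolding jtheta_def by (subst qpoch_inf_shift[of "q / (q * x)"]) (simp add: mult_ac)
  moreover have "1 - 1 / x = - ((1 - x) / x)"
    using assms by (simp add: field_simps)
  ultimately show ?thesis by simp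
qed

lemma jtheta_q_divide: "x \<noteq> 0 \<Longrightarrow> jtheta (q / x) q = jtheta x q"
  by (simp add: jtheta_def)

lemma jtheta_inverse:
  assumes "x \<noteq> 0"
  shows "jtheta (1 / x) q = - jtheta x q / x"
  using jtheta_q_divide[of "q * x"] jtheta_q_mult[of x] assms by simp

lemma jtheta_1 [simp]: "jtheta 1 q = 0"
  by (simp add: jtheta_def)

text \<open>The left side is invariant under \<open>s -> s + 1\<close> because
  \<open>tri (s + 1) = tri s + s\<close>; so the induction can run from 0 in both
  directions.\<close>

lemma jtheta_powi_mult:
  assumes "x \<noteq> 0"
  shows "(-1) powi s * q powi (tri s) * x powi s * jtheta (q powi s * x) q = jtheta x q"
proof -
  have step: "(-1) powi (s + 1) * q powi (tri (s + 1)) * x powi (s + 1) * jtheta (q powi (s + 1) * x) q =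
              (-1) powi s * q powi (tri s) * x powi s * jtheta (q powi s * x) q" for s
  proof -
    have "jtheta (q powi (s + 1) * x) q = jtheta (q * (q powi s * x)) q"
      by (simp add: power_int_add mult_ac)
    also have "\<dots> = - jtheta (q powi s * x) q / (q powi s * x)"
      using assms by (intro jtheta_q_mult) simp
    finally show ?thesis
      unfolding tri_add_1 using assms by (simp add: power_int_add)
  qed
  show ?thesis
  proof (induction s rule: int_induct[where k = 0])
    case (step1 i)
    thus ?case using step[of i] by simp
  next
    case (step2 i)
    thus ?case using step[of "i - 1"] by simp
  qed simp
qed

text \<open>Zeros with exponent at most 0 come from the first product, those with exponent at least
  1 from the second.\<close>

lemma jtheta_eq_0_iff:
  assumes "x \<noteq> 0"
  shows "jtheta x q = 0 \<longleftrightarrow> (\<exists>n::int. x = q powi n)"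
proof
  assume "jtheta x q = 0"
  then consider n where "x * q ^ n = 1" | n where "q / x * q ^ n = 1"
    using qpoch_inf_q_nz by (auto simp: jtheta_def qpoch_inf_eq_0_iff[of x] qpoch_inf_eq_0_iff[of "q / x"])
  thus "\<exists>n::int. x = q powi n"
  proof cases
    case 1
    hence "x = q powi (- int n)"
      by (simp add: power_int_minus field_simps)
    thus ?thesis by blast
  next
    case 2
    hence "x = q powi (int (Suc n))"
      using assms by (simp add: power_int_of_nat field_simps del: of_nat_Suc)
    thus ?thesis by blast
  qed
next
  assume "\<exists>n::int. x = q powi n"
  then obtain n where n: "x = q powi n" by blast
  show "jtheta x q = 0"
    using jtheta_powi_mult[of 1 n] n by auto
qed

text \<open>One majorant for both signs: \<open>tri (-m)\<close> equals \<open>m(m+1)/2\<close>,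
  while \<open>tri m\<close> is smaller by \<open>m\<close>, whence the division of
  \<open>norm z\<close> by \<open>norm q\<close>. The sum of the two bases dominates each.\<close>

lemma norm_theta_term_le:
  assumes "z \<noteq> 0"
  shows "norm (q powi (tri k) * z powi k) \<le>
           norm q ^ (nat \<bar>k\<bar> * (nat \<bar>k\<bar> + 1) div 2) * (norm z / norm q + 1 / norm z) ^ nat \<bar>k\<bar>"
proof (cases "k \<ge> 0")
  case True
  then obtain m where m: "k = int m"
    using nonneg_int_cases by blast
  have "m * (m + 1) div 2 = m * (m - 1) div 2 + m"
    by (cases m) (simp_all add: algebra_simps)
  hence "norm (q powi (tri k) * z powi k) = norm q ^ (m * (m + 1) div 2) * (norm z / norm q) ^ m"
    by (simp add: m tri_of_nat norm_mult norm_power power_add power_divide)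
  also have "\<dots> \<le> norm q ^ (m * (m + 1) div 2) * (norm z / norm q + 1 / norm z) ^ m"
    by (intro mult_left_mono power_mono) auto
  finally show ?thesis by (simp add: m)
next
  case False
  then obtain m where m: "k = - int m"
    by (metis linear nonpos_int_cases)
  have "norm (q powi (tri k) * z powi k) = norm q ^ (m * (m + 1) div 2) * (1 / norm z) ^ m"
    unfolding m tri_minus_of_nat
    by (simp add: norm_mult norm_power power_divide power_int_minus norm_inverse divide_inverse power_inverse)
  also have "\<dots> \<le> norm q ^ (m * (m + 1) div 2) * (norm z / norm q + 1 / norm z) ^ m"
    by (intro mult_left_mono power_mono) auto
  finally show ?thesis by (simp add: m)
qed

lemma theta_term_abs_summable:
  assumes "z \<noteq> 0"
  shows "(\<lambda>k. norm (q powi (tri k) * z powi k)) summable_on UNIV"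
proof (rule summable_on_comparison_test)
  show "(\<lambda>k::int. norm q ^ (nat \<bar>k\<bar> * (nat \<bar>k\<bar> + 1) div 2) * (norm z / norm q + 1 / norm z) ^ nat \<bar>k\<bar>)
          summable_on UNIV"
    by (rule summable_on_int_abs, rule summable_gauss) (use q_lt_1 in auto)
qed (use norm_theta_term_le[OF assms] in auto)

text \<open>The convention \<open>1 / (q;q)\<^bsub>m\<^esub> = 0\<close> for \<open>m < 0\<close> makes the recurrence below hold for all integers
  and lets the finite triple product be summed over all of them.\<close>

definition rpoch :: "int \<Rightarrow> complex" where
  "rpoch m = (if m < 0 then 0 else 1 / qpoch q q (nat m))"

lemma qpoch_q_nz [simp]: "qpoch q q n \<noteq> 0"
  using qpoch_inf_split[of q n] qpoch_inf_q_nz by force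

text \<open>At \<open>m = -1\<close> the factor \<open>1 - q powi 0\<close> vanishes, which
  reconciles the value 0 on the left with \<open>rpoch 0 = 1\<close>.\<close>

lemma rpoch_step: "rpoch m = (1 - q powi (m + 1)) * rpoch (m + 1)"
proof -
  consider "m < -1" | "m = -1" | "m \<ge> 0" by linarith
  thus ?thesis
  proof cases
    case 3
    then obtain n where n: "m = int n"
      using nonneg_int_cases by blast
    have "nat (int n + 1) = Suc n" by simp
    moreover have "q powi (int n + 1) = q * q ^ n"
      by (simp add: power_int_add)
    moreover have "1 - q * q ^ n \<noteq> 0"
      using power_q_neq_1[of "Suc n"] by simp
    ultimately show ?thesis
      by (simp add: rpoch_def n qpoch_Suc)
  qed (auto simp: rpoch_def)
qed

text \<open>The q-binomial coefficient of \<open>2 n\<close> over \<open>n + k\<close> times a term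
  of the theta series; it is 0 unless \<open>-n <= k <= n\<close>.\<close>

definition ftheta_term :: "nat \<Rightarrow> complex \<Rightarrow> int \<Rightarrow> complex" where
  "ftheta_term n z k = qpoch q q (2 * n) * rpoch (int n + k) * rpoch (int n - k) *
                       ((-1) powi k * q powi (tri k) * z powi k)"

text \<open>The coefficients are those of \<open>(1 - z q^n)(1 - q^(n+1)/z)\<close>, the factors
  that the finite product gains.\<close>

lemma ftheta_term_Suc:
  assumes "z \<noteq> 0"
  shows "ftheta_term (Suc n) z k =
           (1 + q ^ (2 * n + 1)) * ftheta_term n z k - q ^ n * z * ftheta_term n z (k - 1)
           - q ^ (n + 1) / z * ftheta_term n z (k + 1)"
proof -
  \<comment> \<open>By \<open>rpoch_step\<close> every \<open>rpoch\<close> value that occurs is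
    \<open>X\<close> or \<open>Y\<close> times a polynomial in \<alpha> and \<beta>, without
    division. The recurrence becomes a polynomial identity.\<close>
  define X Y \<alpha> \<beta> where "X = rpoch (int n + k + 1)" and "Y = rpoch (int n - k + 1)"
    and "\<alpha> = q powi (int n + k)" and "\<beta> = q powi (int n - k)"
  define T where "T = (-1) powi k * q powi (tri k) * z powi k"
  define D where "D = qpoch q q (2 * n)"
  have \<alpha>\<beta>: "\<alpha> * \<beta> = q ^ (2 * n)"
    by (simp add: \<alpha>_def \<beta>_def flip: power_int_add power_int_of_nat)
  have r1: "rpoch (int n + k) = (1 - q * \<alpha>) * X"
    by (subst rpoch_step) (simp add: X_def \<alpha>_def power_int_add)
  have r2: "rpoch (int n - k) = (1 - q * \<beta>) * Y"
    by (subst rpoch_step) (simp add: Y_def \<beta>_def power_int_add power_int_diff)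
  have r3: "rpoch (int n + (k - 1)) = (1 - \<alpha>) * ((1 - q * \<alpha>) * X)"
    by (subst rpoch_step) (simp add: r1 flip: \<alpha>_def)
  have r4: "rpoch (int n - (k + 1)) = (1 - \<beta>) * ((1 - q * \<beta>) * Y)"
  proof -
    have "int n - (k + 1) + 1 = int n - k" by simp
    thus ?thesis by (subst rpoch_step) (simp only: r2 \<beta>_def)
  qed
  have r5: "rpoch (int n - (k - 1)) = Y" "rpoch (int n + (k + 1)) = X"
       "rpoch (int (Suc n) + k) = X" "rpoch (int (Suc n) - k) = Y"
    by (simp_all add: X_def Y_def algebra_simps)
  have t1: "(-1) powi (k - 1) * q powi (tri (k - 1)) * z powi (k - 1) = - T * q / (q powi k * z)"
  proof -
    have *: "tri (k - 1) = tri k - k + 1" using tri_add_1[of "k - 1"] by simp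
    show ?thesis
      unfolding * using assms by (simp add: T_def power_int_add power_int_diff field_simps)
  qed
  have t2: "(-1) powi (k + 1) * q powi (tri (k + 1)) * z powi (k + 1) = - T * q powi k * z"
    unfolding tri_add_1 using assms by (simp add: T_def power_int_add field_simps)
  have a: "q ^ n * q / q powi k = q * \<beta>" "q ^ (n + 1) * q powi k = q * \<alpha>"
    by (simp_all add: \<alpha>_def \<beta>_def power_int_add power_int_diff)
  have s1: "q ^ n * z * ftheta_term n z (k - 1) = - D * (q * \<beta>) * (1 - \<alpha>) * (1 - q * \<alpha>) * X * Y * T"
    unfolding ftheta_term_def t1 r3 r5 D_def[symmetric] a(1)[symmetric] using assms by (simp add: field_simps)
  have s2: "q ^ (n + 1) / z * ftheta_term n z (k + 1) = - D * (q * \<alpha>) * (1 - \<beta>) * (1 - q * \<beta>) * X * Y * T"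
    unfolding ftheta_term_def t2 r4 r5 D_def[symmetric] a(2)[symmetric] using assms by (simp add: field_simps)
  have s3: "ftheta_term n z k = D * ((1 - q * \<alpha>) * X) * ((1 - q * \<beta>) * Y) * T"
    unfolding ftheta_term_def r1 r2 D_def T_def ..
  have "qpoch q q (2 * Suc n) = D * (1 - q * q ^ (2 * n)) * (1 - q * q * q ^ (2 * n))"
    by (simp add: D_def qpoch_Suc mult_ac)
  hence s4: "ftheta_term (Suc n) z k = D * (1 - q * (\<alpha> * \<beta>)) * (1 - q * q * (\<alpha> * \<beta>)) * X * Y * T"
    unfolding ftheta_term_def r5 T_def \<alpha>\<beta> by simp
  have s5: "q ^ (2 * n + 1) = q * (\<alpha> * \<beta>)"
    by (simp add: \<alpha>\<beta>)
  show ?thesis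
    unfolding s1 s2 s3 s4 s5 by (simp add: algebra_simps)
qed

lemma finite_triple_product:
  assumes "z \<noteq> 0"
  shows "(ftheta_term n z has_sum (qpoch z q n * qpoch (q / z) q n)) UNIV"
proof (induction n)
  case 0
  have "ftheta_term 0 z k = (if k = 0 then 1 else 0)" for k
    by (auto simp: ftheta_term_def rpoch_def)
  thus ?case
    by (intro has_sum_finite_neutralI[of "{0}"]) auto
next
  case (Suc n)
  let ?S = "qpoch z q n * qpoch (q / z) q n"
  have 1: "((\<lambda>k. ftheta_term n z (k - 1)) has_sum ?S) UNIV"
    by (subst has_sum_reindex_bij_witness[of _ "\<lambda>k. k + 1" "\<lambda>k. k - 1" UNIV "ftheta_term n z"])
       (use Suc.IH in auto)
  have 2: "((\<lambda>k. ftheta_term n z (k + 1)) has_sum ?S) UNIV"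
    by (subst has_sum_reindex_bij_witness[of _ "\<lambda>k. k - 1" "\<lambda>k. k + 1" UNIV "ftheta_term n z"])
       (use Suc.IH in auto)
  have "((\<lambda>k. (1 + q ^ (2 * n + 1)) * ftheta_term n z k + (- (q ^ n * z)) * ftheta_term n z (k - 1)
           + (- (q ^ (n + 1) / z)) * ftheta_term n z (k + 1)) has_sum
         ((1 + q ^ (2 * n + 1)) * ?S + (- (q ^ n * z)) * ?S + (- (q ^ (n + 1) / z)) * ?S)) UNIV"
    by (intro has_sum_add has_sum_cmult_right Suc.IH 1 2)
  also have "(\<lambda>k. (1 + q ^ (2 * n + 1)) * ftheta_term n z k + (- (q ^ n * z)) * ftheta_term n z (k - 1)
           + (- (q ^ (n + 1) / z)) * ftheta_term n z (k + 1)) = ftheta_term (Suc n) z"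
    using ftheta_term_Suc[OF assms, of n] by (auto simp: fun_eq_iff)
  also have "(1 + q ^ (2 * n + 1)) * ?S + (- (q ^ n * z)) * ?S + (- (q ^ (n + 1) / z)) * ?S =
             qpoch z q (Suc n) * qpoch (q / z) q (Suc n)"
  proof -
    have "q ^ (2 * n + 1) = q ^ n * q ^ n * q" 
      by (simp add: mult_2 power_add)
    thus ?thesis
      using assms unfolding qpoch_Suc by (simp add: field_simps)
  qed
  finally show ?case .
qed

text \<open>Provides a majorant of \<open>ftheta_term n z\<close> independent of
  \<open>n\<close>.\<close>

lemma rpoch_bounded: "\<exists>C. \<forall>m. norm (rpoch m) \<le> C"
proof -
  have "(\<lambda>n. 1 / qpoch q q n) \<longlonglongrightarrow> 1 / qpoch_inf q q"
    by (intro tendsto_intros qpoch_tendsto) auto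
  hence "Bseq (\<lambda>n. 1 / qpoch q q n)"
    using convergent_imp_Bseq convergentI by blast
  then obtain C where C: "C > 0" "\<And>n. norm (1 / qpoch q q n) \<le> C"
    unfolding Bseq_def by blast
  hence "norm (rpoch m) \<le> C" for m
    by (auto simp: rpoch_def)
  thus ?thesis by blast
qed

text \<open>Let \<open>n\<close> tend to infinity in the finite form, exchanging limit and sum by dominated convergence.\<close>

theorem jacobi_triple_product:
  assumes "z \<noteq> 0"
  shows "((\<lambda>k. (-1) powi k * q powi (tri k) * z powi k) has_sum jtheta z q) UNIV"
proof -
  define t where "t = (\<lambda>k. (-1) powi k * q powi (tri k) * z powi k)"
  have norm_t: "norm (t k) = norm (q powi (tri k) * z powi k)" for k
    by (simp add: t_def norm_mult norm_power_int)
  have t_summable: "(\<lambda>k. norm (t k)) summable_on UNIV"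
    unfolding norm_t by (rule theta_term_abs_summable) fact
  have t: "t summable_on UNIV"
    by (rule abs_summable_summable) fact
  obtain C where C: "\<And>m. norm (rpoch m) \<le> C"
    using rpoch_bounded by blast
  have C0: "C \<ge> 0" using C[of 0] norm_ge_zero order_trans by blast
  define B where "B = exp (norm q / (1 - norm q))"
  have le: "norm (ftheta_term n z k) \<le> B * C * C * norm (t k)" for n k
  proof -
    have "ftheta_term n z k = qpoch q q (2 * n) * rpoch (int n + k) * rpoch (int n - k) * t k"
      by (simp add: ftheta_term_def t_def)
    hence "norm (ftheta_term n z k) =
             norm (qpoch q q (2 * n)) * norm (rpoch (int n + k)) * norm (rpoch (int n - k)) * norm (t k)"
      by (simp add: norm_mult)
    also have "norm (qpoch q q (2 * n)) \<le> B"
      unfolding B_def by (rule norm_qpoch_le) simp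
    hence "norm (qpoch q q (2 * n)) * norm (rpoch (int n + k)) * norm (rpoch (int n - k)) * norm (t k)
             \<le> B * C * C * norm (t k)"
      by (intro mult_mono C) (use C0 in \<open>simp_all add: B_def\<close>)
    finally show ?thesis .
  qed
  have ul: "uniform_limit UNIV (\<lambda>X n. \<Sum>k\<in>X. ftheta_term n z k)
              (\<lambda>n. qpoch z q n * qpoch (q / z) q n) (finite_subsets_at_top UNIV)"
    by (rule Weierstrass_m_test_general'[OF le finite_triple_product[OF assms]])
       (intro summable_on_cmult_right t_summable)
  have rl: "(\<lambda>n. rpoch (int n + k)) \<longlonglongrightarrow> 1 / qpoch_inf q q" for k
  proof -
    have "eventually (\<lambda>n. 1 / qpoch q q (nat (int n + k)) = rpoch (int n + k)) sequentially"
      using eventually_ge_at_top[of "nat (- k)"] by eventually_elim (auto simp: rpoch_def)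
    moreover have "filterlim (\<lambda>n. nat (int n + k)) at_top sequentially"
      unfolding filterlim_at_top
    proof
      fix Z :: nat
      show "eventually (\<lambda>n. Z \<le> nat (int n + k)) sequentially"
        using eventually_ge_at_top[of "Z + nat \<bar>k\<bar>"] by eventually_elim linarith
    qed
    hence "(\<lambda>n. qpoch q q (nat (int n + k))) \<longlonglongrightarrow> qpoch_inf q q"
      by (rule filterlim_compose[OF qpoch_tendsto])
    hence "(\<lambda>n. 1 / qpoch q q (nat (int n + k))) \<longlonglongrightarrow> 1 / qpoch_inf q q"
      by (rule tendsto_divide[OF tendsto_const]) (rule qpoch_inf_q_nz)
    ultimately show ?thesis
      by (rule Lim_transform_eventually[rotated])
  qed
  \<comment> \<open>The q-binomial coefficient tends to the reciprocal of
    \<open>qpoch_inf q q\<close>; moved to the other side, this is the third product in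
    \<open>jtheta\<close>.\<close>
  have lim: "(\<lambda>n. ftheta_term n z k) \<longlonglongrightarrow> 1 / qpoch_inf q q * t k" for k
  proof -
    have "filterlim (\<lambda>n::nat. 2 * n) at_top sequentially"
      by (rule filterlim_subseq) (auto simp: strict_mono_def)
    from filterlim_compose[OF qpoch_tendsto[of q] this]
      have "(\<lambda>n. ftheta_term n z k) \<longlonglongrightarrow> qpoch_inf q q * (1 / qpoch_inf q q) * (1 / qpoch_inf q q) * t k"
      unfolding ftheta_term_def t_def using rl[of k] rl[of "-k"]
      by (intro tendsto_mult tendsto_const) simp_all
    thus ?thesis by simp
  qed
  have "((\<lambda>n. qpoch z q n * qpoch (q / z) q n) \<longlongrightarrow> 1 / qpoch_inf q q * (\<Sum>\<^sub>\<infinity>k. t k)) sequentially"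
  proof (rule swap_uniform_limit'[OF _ _ ul])
    show "\<forall>\<^sub>F X in finite_subsets_at_top UNIV.
            (\<lambda>n. \<Sum>k\<in>X. ftheta_term n z k) \<longlonglongrightarrow> (\<Sum>k\<in>X. 1 / qpoch_inf q q * t k)"
      by (intro always_eventually allI tendsto_sum lim)
    show "((\<lambda>X. \<Sum>k\<in>X. 1 / qpoch_inf q q * t k) \<longlongrightarrow> 1 / qpoch_inf q q * (\<Sum>\<^sub>\<infinity>k. t k))
            (finite_subsets_at_top UNIV)"
      using has_sum_cmult_right[OF has_sum_infsum[OF t], of "1 / qpoch_inf q q"]
      by (simp only: has_sum_def)
  qed auto
  moreover have "(\<lambda>n. qpoch z q n * qpoch (q / z) q n) \<longlonglongrightarrow> qpoch_inf z q * qpoch_inf (q / z) q"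
    by (intro tendsto_intros qpoch_tendsto)
  ultimately have "1 / qpoch_inf q q * (\<Sum>\<^sub>\<infinity>k. t k) = qpoch_inf z q * qpoch_inf (q / z) q"
    by (rule LIMSEQ_unique)
  hence "(\<Sum>\<^sub>\<infinity>k. t k) = jtheta z q"
    by (simp add: jtheta_def field_simps)
  thus ?thesis
    using has_sum_infsum[OF t] unfolding t_def by simp
qed

end

section \<open>Appell--Lerch sums as functions on the punctured plane\<close>

text \<open>Majorants are asked for on the annuli \<open>1/R <= norm x <= R\<close>, suited to terms
  containing both \<open>x\<close> and \<open>1/x\<close>. Every point has a closed disc inside such
  an annulus, and there the convergence is uniform.\<close>

lemma holomorphic_infsum_punctured:
  fixes f :: "'a \<Rightarrow> complex \<Rightarrow> complex"
  assumes hol: "\<And>s. f s holomorphic_on -{0}"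
    and bound: "\<And>R. \<exists>M. M summable_on UNIV \<and>
                  (\<forall>x s. x \<noteq> 0 \<longrightarrow> norm x \<le> R \<longrightarrow> norm (1 / x) \<le> R \<longrightarrow> norm (f s x) \<le> M s)"
  shows "(\<lambda>x. \<Sum>\<^sub>\<infinity>s. f s x) holomorphic_on -{0}"
proof -
  have "\<exists>r>0. (\<lambda>x. \<Sum>\<^sub>\<infinity>s. f s x) holomorphic_on ball z r" if z: "z \<noteq> 0" for z
  proof -
    \<comment> \<open>The closed disc of this radius around \<open>z\<close> lies between the moduli
      \<open>r\<close> and \<open>3 * r\<close>, which dictates \<open>R\<close>.\<close>
    define r where "r = norm z / 2"
    have r: "r > 0" using z by (simp add: r_def)
    define R where "R = max (3 * r) (1 / r)"
    obtain M where M: "M summable_on UNIV"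
      "\<And>x s. x \<noteq> 0 \<Longrightarrow> norm x \<le> R \<Longrightarrow> norm (1 / x) \<le> R \<Longrightarrow> norm (f s x) \<le> M s"
      using bound[of R] by blast
    have norms: "r \<le> norm x" "norm x \<le> 3 * r" if "x \<in> cball z r" for x
    proof -
      have "norm (z - x) \<le> r" using that by (simp add: dist_norm)
      thus "r \<le> norm x" "norm x \<le> 3 * r"
        using norm_triangle_ineq2[of z x] norm_triangle_ineq2[of x z]
        unfolding norm_minus_commute[of x z] r_def by linarith+
    qed
    have nz: "x \<noteq> 0" if "x \<in> cball z r" for x
      using norms[OF that] r by auto
    have le: "norm (f s x) \<le> M s" if "x \<in> cball z r" for s x
    proof (rule M(2))
      show "x \<noteq> 0" by (rule nz) fact
      show "norm x \<le> R" using norms[OF that] by (auto simp: R_def)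
      have "norm (1 / x) \<le> 1 / r"
        using norms[OF that] r nz[OF that] by (auto simp: norm_divide intro!: frac_le)
      thus "norm (1 / x) \<le> R" by (auto simp: R_def)
    qed
    have ul: "uniform_limit (cball z r) (\<lambda>X x. \<Sum>s\<in>X. f s x) (\<lambda>x. \<Sum>\<^sub>\<infinity>s. f s x)
                (finite_subsets_at_top UNIV)"
      by (rule Weierstrass_m_test_general[OF le M(1)])
    have "continuous_on (cball z r) (\<lambda>x. \<Sum>s\<in>X. f s x) \<and>
          (\<lambda>x. \<Sum>s\<in>X. f s x) holomorphic_on ball z r" for X
    proof
      have "(\<lambda>x. \<Sum>s\<in>X. f s x) holomorphic_on -{0}"
        by (intro holomorphic_intros hol)
      hence *: "(\<lambda>x. \<Sum>s\<in>X. f s x) holomorphic_on cball z r"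
        by (rule holomorphic_on_subset) (use nz in blast)
      show "continuous_on (cball z r) (\<lambda>x. \<Sum>s\<in>X. f s x)"
        using * by (rule holomorphic_on_imp_continuous_on)
      show "(\<lambda>x. \<Sum>s\<in>X. f s x) holomorphic_on ball z r"
        using * by (rule holomorphic_on_subset) auto
    qed
    hence "\<forall>\<^sub>F X in finite_subsets_at_top UNIV. continuous_on (cball z r) (\<lambda>x. \<Sum>s\<in>X. f s x) \<and>
             (\<lambda>x. \<Sum>s\<in>X. f s x) holomorphic_on ball z r"
      by simp
    from holomorphic_uniform_limit[OF this ul] r show ?thesis by auto
  qed
  hence "(\<lambda>x. \<Sum>\<^sub>\<infinity>s. f s x) analytic_on -{0}"
    unfolding analytic_on_def by auto
  thus ?thesis by (rule analytic_imp_holomorphic)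
qed

context nome
begin

text \<open>\<open>jtheta y q / (1 - y)\<close> as a product, hence meaningful at
  \<open>y = 1\<close> too. It represents \<open>jtheta\<close> divided by one denominator of an
  Appell--Lerch sum.\<close>

definition psi :: "complex \<Rightarrow> complex" where
  "psi y = qpoch_inf (q * y) q * qpoch_inf (q / y) q * qpoch_inf q q"

lemma jtheta_psi: "jtheta y q = (1 - y) * psi y"
  unfolding jtheta_def psi_def by (subst qpoch_inf_shift) (simp add: mult_ac)

lemma psi_1: "psi 1 = qpoch_inf q q ^ 3"
  by (simp add: psi_def power3_eq_cube)

lemma psi_inverse: "psi (1 / y) = psi y"
  by (simp add: psi_def mult_ac)

lemma powi_q_neq_1: "s \<noteq> 0 \<Longrightarrow> q powi s \<noteq> 1"
  using power_q_neq_1[of "nat s"] power_q_neq_1[of "nat (-s)"]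
  by (cases "s > 0") (auto simp: power_int_def power_inverse)

lemma psi_powi_q:
  assumes "s \<noteq> 0"
  shows "psi (q powi s) = 0"
proof -
  have "jtheta (q powi s) q = 0"
    by (subst jtheta_eq_0_iff) auto
  thus ?thesis
    using powi_q_neq_1[OF assms] by (simp add: jtheta_psi)
qed

lemma psi_holomorphic [holomorphic_intros]:
  assumes "f holomorphic_on A" "\<And>x. x \<in> A \<Longrightarrow> f x \<noteq> 0"
  shows "(\<lambda>x. psi (f x)) holomorphic_on A"
  unfolding psi_def by (intro holomorphic_intros assms) (use assms in auto)

lemma jtheta_holomorphic [holomorphic_intros]:
  assumes "f holomorphic_on A" "\<And>x. x \<in> A \<Longrightarrow> f x \<noteq> 0"
  shows "(\<lambda>x. jtheta (f x) q) holomorphic_on A"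
  unfolding jtheta_def by (intro holomorphic_intros assms) (use assms in auto)

text \<open>Each step in \<open>n\<close> adds the factor \<open>1 - 1/(q^n y)\<close> to the second
  product; multiplied by \<open>q^n\<close> it becomes \<open>q^n - 1/y\<close>, of modulus at most
  \<open>1 + R\<close>. A detour through \<open>jtheta\<close> would divide by
  \<open>1 - q^n y\<close>, which may vanish.\<close>

lemma norm_psi_le:
  assumes "y \<noteq> 0" "norm y \<le> R" "norm (1 / y) \<le> R"
  shows "norm q ^ (n * (n - 1) div 2) * norm (psi (q ^ n * y)) \<le>
           (1 + R) ^ n * exp (R / (1 - norm q)) ^ 3"
proof -
  define B where "B = exp (R / (1 - norm q))"
  \<comment> \<open>\<open>y\<close> and \<open>1/y\<close> cannot both lie inside the unit
    disc.\<close>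
  have R: "R \<ge> 1"
  proof (rule ccontr)
    assume "\<not> R \<ge> 1"
    hence "norm y < 1" "norm (1 / y) < 1" using assms by auto
    thus False using assms(1) by (auto simp: norm_divide field_simps)
  qed
  have le: "norm (q * x) \<le> R" if "norm x \<le> R" for x
    using that q_lt_1 mult_mono[of "norm q" 1 "norm x" R] R by (auto simp: norm_mult)
  have "norm (q ^ n * y) \<le> R" for n
    using le by (induction n) (use assms in \<open>auto simp: mult.assoc\<close>)
  hence 1: "norm (qpoch_inf (q * (q ^ n * y)) q) \<le> B"
    unfolding B_def by (intro norm_qpoch_inf_le le)
  have 2: "norm (qpoch_inf q q) \<le> B"
    unfolding B_def using q_lt_1 R by (intro norm_qpoch_inf_le) auto
  have 3: "norm q ^ (n * (n - 1) div 2) * norm (qpoch_inf (q / (q ^ n * y)) q) \<le> (1 + R) ^ n * B"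
  proof (induction n)
    case 0
    show ?case
      using le[of "1 / y"] assms unfolding B_def by (auto intro!: norm_qpoch_inf_le)
  next
    case (Suc n)
    have e: "Suc n * (Suc n - 1) div 2 = n * (n - 1) div 2 + n"
      by (cases n) (simp_all add: algebra_simps)
    have "qpoch_inf (q / (q ^ Suc n * y)) q =
            (1 - 1 / (q ^ n * y)) * qpoch_inf (q / (q ^ n * y)) q"
      by (subst qpoch_inf_shift) simp
    hence "norm q ^ (Suc n * (Suc n - 1) div 2) * norm (qpoch_inf (q / (q ^ Suc n * y)) q) =
             norm (q ^ n * (1 - 1 / (q ^ n * y))) *
             (norm q ^ (n * (n - 1) div 2) * norm (qpoch_inf (q / (q ^ n * y)) q))"
      unfolding e by (simp add: norm_mult norm_power power_add mult_ac)
    also have "q ^ n * (1 - 1 / (q ^ n * y)) = q ^ n - 1 / y"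
      by (simp add: field_simps)
    also have "norm (q ^ n - 1 / y) *
                 (norm q ^ (n * (n - 1) div 2) * norm (qpoch_inf (q / (q ^ n * y)) q)) \<le>
               (1 + R) * ((1 + R) ^ n * B)"
    proof (rule mult_mono[OF _ Suc.IH])
      have "norm (q ^ n - 1 / y) \<le> norm (q ^ n) + norm (1 / y)"
        by (rule norm_triangle_ineq4)
      also have "norm (q ^ n) \<le> 1"
        using q_lt_1 by (simp add: norm_power power_le_one)
      finally show "norm (q ^ n - 1 / y) \<le> 1 + R"
        using assms(3) by linarith
    qed (use R in auto)
    finally show ?case by (simp add: mult_ac)
  qed
  have "norm q ^ (n * (n - 1) div 2) * norm (psi (q ^ n * y)) =
          (norm q ^ (n * (n - 1) div 2) * norm (qpoch_inf (q / (q ^ n * y)) q)) *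
          norm (qpoch_inf (q * (q ^ n * y)) q) * norm (qpoch_inf q q)"
    unfolding psi_def norm_mult by (simp add: mult_ac)
  also have "\<dots> \<le> ((1 + R) ^ n * B) * B * B"
    by (intro mult_mono 1 2 3) (use R in \<open>auto simp: B_def\<close>)
  finally show ?thesis
    by (simp add: B_def power3_eq_cube mult_ac)
qed

text \<open>Up to a factor, \<open>Phi (x z) (z\<^sup>2 x)\<close> is \<open>j(z) j(x z) m(x,q,z)\<close>: multiplying the sum by \<open>j(x z)\<close> and using
  its quasi-periodicity cancels every denominator, see \<open>appell_m_Phi\<close>.\<close>

definition phi_term :: "complex \<Rightarrow> complex \<Rightarrow> int \<Rightarrow> complex" where
  "phi_term y w s = q powi (s * s) * w powi s * psi (q powi s * y)"

definition Phi :: "complex \<Rightarrow> complex \<Rightarrow> complex" where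
  "Phi y w = (\<Sum>\<^sub>\<infinity>s. phi_term y w s)"

definition phi_bound :: "real \<Rightarrow> int \<Rightarrow> real" where
  "phi_bound R s = exp (R / (1 - norm q)) ^ 3 *
     (norm q ^ (nat \<bar>s\<bar> * (nat \<bar>s\<bar> + 1) div 2) * (R * (1 + R)) ^ nat \<bar>s\<bar>)"

text \<open>Inversion symmetry of \<open>psi\<close>; it reduces estimates for negative indices to
  nonnegative ones.\<close>

lemma phi_term_minus: "phi_term y w (- s) = phi_term (1 / y) (1 / w) s"
proof -
  have "psi (q powi (- s) * y) = psi (q powi s * (1 / y))"
    by (subst psi_inverse [symmetric]) (simp add: power_int_minus field_simps)
  thus ?thesis
    by (simp add: phi_term_def power_int_minus power_int_inverse divide_inverse)
qed

lemma norm_phi_term_le_aux: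
  assumes "y \<noteq> 0" "norm y \<le> R" "norm (1 / y) \<le> R" "norm w \<le> R"
  shows "norm (phi_term y w (int n)) \<le> phi_bound R (int n)"
proof -
  define B where "B = exp (R / (1 - norm q))"
  have R: "R \<ge> 0" using assms norm_ge_zero order_trans by blast
  \<comment> \<open>The part \<open>n(n-1)/2\<close> of the exponent compensates the growth of
    \<open>psi (q^n y)\<close>; the part \<open>n(n+1)/2\<close> remains for convergence.\<close>
  have *: "n * n = n * (n + 1) div 2 + n * (n - 1) div 2"
  proof (cases n)
    case (Suc m)
    have "2 * (n * (n - 1) div 2) = n * (n - 1)"
      by (rule dvd_mult_div_cancel) (simp add: Suc)
    moreover have "n * (n + 1) div 2 = n * (n - 1) div 2 + n" "n * n = n * (n - 1) + n"
      by (simp_all add: Suc algebra_simps)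
    ultimately show ?thesis by linarith
  qed simp
  have "norm (phi_term y w (int n)) = norm q ^ (n * n) * norm w ^ n * norm (psi (q ^ n * y))"
    by (simp add: phi_term_def norm_mult norm_power flip: of_nat_mult)
  also have "\<dots> = norm q ^ (n * (n + 1) div 2) * norm w ^ n *
                   (norm q ^ (n * (n - 1) div 2) * norm (psi (q ^ n * y)))"
    unfolding * power_add by (simp add: mult_ac)
  also have "\<dots> \<le> norm q ^ (n * (n + 1) div 2) * R ^ n * ((1 + R) ^ n * B ^ 3)"
    unfolding B_def
    by (intro mult_mono norm_psi_le assms power_mono) (use R in auto)
  also have "\<dots> = phi_bound R (int n)"
    by (simp add: phi_bound_def B_def power_mult_distrib mult_ac)
  finally show ?thesis .
qed

lemma norm_phi_term_le:
  assumes "y \<noteq> 0" "norm y \<le> R" "norm (1 / y) \<le> R" "norm w \<le> R" "norm (1 / w) \<le> R"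
  shows "norm (phi_term y w s) \<le> phi_bound R s"
proof (cases "s \<ge> 0")
  case True
  then obtain n where "s = int n" using nonneg_int_cases by blast
  thus ?thesis using norm_phi_term_le_aux assms by blast
next
  case False
  then obtain n where s: "s = - int n" by (metis linear nonpos_int_cases)
  have "phi_bound R (- int n) = phi_bound R (int n)"
    by (simp add: phi_bound_def)
  thus ?thesis
    unfolding s phi_term_minus using norm_phi_term_le_aux[of "1 / y" R "1 / w" n] assms by simp
qed

lemma phi_bound_summable: "phi_bound R summable_on UNIV" if "R \<ge> 0"
  unfolding phi_bound_def
  by (intro summable_on_cmult_right summable_on_int_abs summable_gauss) (use q_lt_1 that in auto)

lemma phi_term_has_sum:
  assumes "y \<noteq> 0"
  shows "(phi_term y w has_sum Phi y w) UNIV"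
proof -
  define R where "R = Max {norm y, norm (1 / y), norm w, norm (1 / w)}"
  have le: "norm (phi_term y w s) \<le> phi_bound R s" for s
    by (rule norm_phi_term_le) (use assms in \<open>simp_all only: R_def, simp_all\<close>)
  have "R \<ge> norm y" by (simp add: R_def)
  hence "R \<ge> 0" using norm_ge_zero order_trans by blast
  hence "(\<lambda>s. norm (phi_term y w s)) summable_on UNIV"
    by (intro summable_on_comparison_test[OF phi_bound_summable]) (use le in auto)
  thus ?thesis
    unfolding Phi_def using abs_summable_summable has_sum_infsum by blast
qed

text \<open>Used with \<open>e = 1\<close>, where both arguments move with \<open>x\<close>, and
  with \<open>e = 0\<close>, where the second is constant.\<close>

lemma Phi_holomorphic:
  assumes "c \<noteq> 0" "d \<noteq> 0"
  shows "(\<lambda>x. Phi (c * x) (d * x ^ e)) holomorphic_on -{0}"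
  unfolding Phi_def
proof (rule holomorphic_infsum_punctured)
  fix s
  show "(\<lambda>x. phi_term (c * x) (d * x ^ e) s) holomorphic_on -{0}"
    unfolding phi_term_def
    by (intro holomorphic_intros) (use assms in auto)
next
  fix R :: real
  define S where "S = norm c * R + R / norm c + norm d * R ^ e + R ^ e / norm d"
  show "\<exists>M. M summable_on UNIV \<and> (\<forall>x s. x \<noteq> 0 \<longrightarrow> norm x \<le> R \<longrightarrow> norm (1 / x) \<le> R \<longrightarrow>
              norm (phi_term (c * x) (d * x ^ e) s) \<le> M s)"
  proof (cases "R \<ge> 0")
    case R: True
    have nn: "norm c * R \<ge> 0" "R / norm c \<ge> 0" "norm d * R ^ e \<ge> 0" "R ^ e / norm d \<ge> 0"
      using R by auto
    have "phi_bound S summable_on UNIV"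
      by (rule phi_bound_summable) (use nn in \<open>auto simp: S_def\<close>)
    moreover have "norm (phi_term (c * x) (d * x ^ e) s) \<le> phi_bound S s"
      if x: "x \<noteq> 0" "norm x \<le> R" "norm (1 / x) \<le> R" for x s
    proof (rule norm_phi_term_le)
      show "c * x \<noteq> 0" using x assms by simp
      have "norm (c * x) \<le> norm c * R"
        using x by (auto simp: norm_mult intro!: mult_left_mono)
      thus "norm (c * x) \<le> S" unfolding S_def using nn by linarith
      have "norm (1 / (c * x)) = norm (1 / x) / norm c"
        by (simp add: norm_divide norm_mult)
      also have "\<dots> \<le> R / norm c"
        using x by (intro divide_right_mono) auto
      finally show "norm (1 / (c * x)) \<le> S" unfolding S_def using nn by linarith
      have "norm (d * x ^ e) \<le> norm d * R ^ e"
        using x by (auto simp: norm_mult norm_power intro!: mult_left_mono power_mono)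
      thus "norm (d * x ^ e) \<le> S" unfolding S_def using nn by linarith
      have "norm (1 / (d * x ^ e)) = norm (1 / x) ^ e / norm d"
        by (simp add: norm_divide norm_mult norm_power power_divide)
      also have "\<dots> \<le> R ^ e / norm d"
        using x by (intro divide_right_mono power_mono) auto
      finally show "norm (1 / (d * x ^ e)) \<le> S" unfolding S_def using nn by linarith
    qed
    ultimately show ?thesis by blast
  next
    case False
    hence "\<not> norm x \<le> R" for x :: complex
      using norm_ge_zero order_trans by blast
    thus ?thesis by (intro exI[of _ "\<lambda>_. 0"]) auto
  qed
qed

lemma tri_add: "tri (s + 1) + tri s = s * s" "2 * tri s = s * s - s"
  using two_tri[of s] unfolding tri_add_1 by (simp_all add: algebra_simps)

lemma q_powi_mult: "q powi a * q powi b = q powi (a + b)"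
  by (simp add: power_int_add)

lemma q_powi_tri:
  "q powi (tri s) * q powi (tri s) = q powi (2 * tri s)"
  "q powi (tri (s + 1)) * q powi (tri s) = q powi (s * s)"
  "q powi (2 * tri s) * q powi s = q powi (s * s)"
  "q powi ((s - 1) * (s - 1)) * q powi (s - 1) = q powi (2 * tri s)"
proof -
  have "tri s + tri s = 2 * tri s" "tri (s + 1) + tri s = s * s" "2 * tri s + s = s * s"
       "(s - 1) * (s - 1) + (s - 1) = 2 * tri s"
    using tri_add[of s] by (simp_all add: algebra_simps)
  thus "q powi (tri s) * q powi (tri s) = q powi (2 * tri s)"
       "q powi (tri (s + 1)) * q powi (tri s) = q powi (s * s)"
       "q powi (2 * tri s) * q powi s = q powi (s * s)"
       "q powi ((s - 1) * (s - 1)) * q powi (s - 1) = q powi (2 * tri s)"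
    by (simp_all only: q_powi_mult)
qed

text \<open>Exhibits a theta value at \<open>q powi s * x\<close>, suitably weighted, as a multiple
  of a term of the Jacobi series at \<open>1/x\<close>.\<close>

lemma jtheta_powi_eq:
  assumes "x \<noteq> 0"
  shows "q powi (2 * tri s) * jtheta (q powi s * x) q =
           (-1) powi s * q powi (tri s) * (1 / x) powi s * jtheta x q"
proof -
  have "(-1) powi s * q powi (tri s) * (1 / x) powi s * jtheta x q =
          ((-1) powi s * (-1) powi s) * (q powi (tri s) * q powi (tri s)) * ((1 / x) powi s * x powi s) *
          jtheta (q powi s * x) q"
    by (subst jtheta_powi_mult[OF assms, of s, symmetric]) (simp only: mult_ac)
  also have "(-1 :: complex) powi s * (-1) powi s = 1"
    by simp
  also have "(1 / x) powi s * x powi s = 1"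
    using assms by (subst power_int_mult_distrib [symmetric]) simp
  also note q_powi_tri(1)
  finally show ?thesis by simp
qed

text \<open>Insert \<open>1 = q^s y + (1 - q^s y)\<close> into the terms: the first part reproduces
  \<open>Phi y w\<close>, in the second the factor completes \<open>psi\<close> to a theta value,
  and the resulting series in \<open>w/y\<close> is summed by the triple product.\<close>

lemma Phi_q_mult:
  assumes "y \<noteq> 0" "w \<noteq> 0"
  shows "w * Phi (q * y) (q * w) = y * Phi y w + jtheta y q * jtheta (w / y) q"
proof (rule has_sum_unique)
  show "((\<lambda>s. w * phi_term (q * y) (q * w) s) has_sum (w * Phi (q * y) (q * w))) UNIV"
    using assms by (intro has_sum_cmult_right phi_term_has_sum) auto
  \<comment> \<open>The index is \<open>s - 1\<close> because
    \<open>q^(s-1) (q y) = q^s y\<close>.\<close>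
  have eq: "w * phi_term (q * y) (q * w) (s - 1) =
          y * phi_term y w s + jtheta y q * ((-1) powi s * q powi (tri s) * (w / y) powi s)" for s
  proof -
    have "w * phi_term (q * y) (q * w) (s - 1) =
            q powi ((s - 1) * (s - 1)) * q powi (s - 1) * w powi s * psi (q powi s * y)"
      using assms by (simp add: phi_term_def power_int_mult_distrib power_int_diff)
    also note q_powi_tri(4)
    also have "q powi (2 * tri s) * w powi s * psi (q powi s * y) =
                 y * (q powi (2 * tri s) * q powi s * w powi s * psi (q powi s * y)) +
                 q powi (2 * tri s) * jtheta (q powi s * y) q * w powi s"
      by (simp add: jtheta_psi algebra_simps)
    also note q_powi_tri(3)
    also have "y * (q powi (s * s) * w powi s * psi (q powi s * y)) = y * phi_term y w s"
      by (simp add: phi_term_def)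
    also have "q powi (2 * tri s) * jtheta (q powi s * y) q * w powi s =
                 jtheta y q * ((-1) powi s * q powi (tri s) * (w / y) powi s)"
      unfolding jtheta_powi_eq[OF assms(1)]
      by (simp add: power_int_divide_distrib)
    finally show ?thesis .
  qed
  have "((\<lambda>s. y * phi_term y w s + jtheta y q * ((-1) powi s * q powi (tri s) * (w / y) powi s)) has_sum
          (y * Phi y w + jtheta y q * jtheta (w / y) q)) UNIV"
    using assms by (intro has_sum_add has_sum_cmult_right phi_term_has_sum jacobi_triple_product) auto
  thus "((\<lambda>s. w * phi_term (q * y) (q * w) s) has_sum
          (y * Phi y w + jtheta y q * jtheta (w / y) q)) UNIV"
    unfolding eq [symmetric]
    by (subst has_sum_reindex_bij_witness[of _ "\<lambda>s. s - 1" "\<lambda>s. s + 1" UNIV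
          "\<lambda>s. w * phi_term (q * y) (q * w) (s - 1)"]) auto
qed

text \<open>Only the first argument moves, so the splitting is
  \<open>1 = q^(2s) x^2 + (1 - q^s x)(1 + q^s x)\<close>; the last factor produces two theta series,
  at \<open>1/x\<close> and at \<open>q/x\<close>.\<close>

lemma Phi_q_mult_q:
  assumes "x \<noteq> 0"
  shows "Phi (q * x) q = x ^ 2 * Phi x q + jtheta x q ^ 2 * (x - 1 / x)"
proof -
  have eq: "phi_term (q * x) q (s - 1) = x ^ 2 * phi_term x q s +
              (jtheta x q * ((-1) powi s * q powi (tri s) * (1 / x) powi s) +
               jtheta x q * x * ((-1) powi s * q powi (tri s) * (q / x) powi s))" for s
  proof -
    have "phi_term (q * x) q (s - 1) =
            q powi ((s - 1) * (s - 1)) * q powi (s - 1) * psi (q powi s * x)"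
      using assms by (simp add: phi_term_def power_int_diff)
    also note q_powi_tri(4)
    also have "q powi (2 * tri s) * psi (q powi s * x) =
                 x ^ 2 * (q powi (2 * tri s) * q powi s * q powi s * psi (q powi s * x)) +
                 q powi (2 * tri s) * jtheta (q powi s * x) q * (1 + q powi s * x)"
      by (simp add: jtheta_psi algebra_simps power2_eq_square)
    also note q_powi_tri(3)
    also have "x ^ 2 * (q powi (s * s) * q powi s * psi (q powi s * x)) = x ^ 2 * phi_term x q s"
      by (simp add: phi_term_def)
    also have "q powi (2 * tri s) * jtheta (q powi s * x) q * (1 + q powi s * x) =
                 jtheta x q * ((-1) powi s * q powi (tri s) * (1 / x) powi s) +
                 jtheta x q * x * ((-1) powi s * q powi (tri s) * (q / x) powi s)"
      unfolding jtheta_powi_eq[OF assms(1)]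
      by (simp add: power_int_divide_distrib algebra_simps add_divide_distrib)
    finally show ?thesis .
  qed
  have "((\<lambda>s. x ^ 2 * phi_term x q s +
              (jtheta x q * ((-1) powi s * q powi (tri s) * (1 / x) powi s) +
               jtheta x q * x * ((-1) powi s * q powi (tri s) * (q / x) powi s))) has_sum
          (x ^ 2 * Phi x q + (jtheta x q * jtheta (1 / x) q + jtheta x q * x * jtheta (q / x) q))) UNIV"
    using assms by (intro has_sum_add has_sum_cmult_right phi_term_has_sum jacobi_triple_product) auto
  hence "(phi_term (q * x) q has_sum
          (x ^ 2 * Phi x q + (jtheta x q * jtheta (1 / x) q + jtheta x q * x * jtheta (q / x) q))) UNIV"
    unfolding eq [symmetric]
    by (subst has_sum_reindex_bij_witness[of _ "\<lambda>s. s - 1" "\<lambda>s. s + 1" UNIV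
          "\<lambda>s. phi_term (q * x) q (s - 1)"]) auto
  hence "Phi (q * x) q = x ^ 2 * Phi x q + (jtheta x q * jtheta (1 / x) q + jtheta x q * x * jtheta (q / x) q)"
    using assms has_sum_unique[OF phi_term_has_sum] by auto
  also have "\<dots> = x ^ 2 * Phi x q + jtheta x q ^ 2 * (x - 1 / x)"
    unfolding jtheta_inverse[OF assms] jtheta_q_divide[OF assms]
    by (simp add: power2_eq_square algebra_simps)
  finally show ?thesis .
qed

text \<open>\<open>psi\<close> vanishes at all powers of \<open>q\<close> except 1, so only
  \<open>s = 0\<close> survives. In the change of \<open>z\<close> this value acts as a
  residue.\<close>

lemma Phi_1: "Phi 1 w = qpoch_inf q q ^ 3"
proof -
  have "phi_term 1 w s = 0" if "s \<noteq> 0" for s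
    using psi_powi_q[OF that] by (simp add: phi_term_def)
  hence "(phi_term 1 w has_sum qpoch_inf q q ^ 3) UNIV"
    by (intro has_sum_finite_neutralI[of "{0}"]) (auto simp: phi_term_def psi_1)
  thus ?thesis
    using phi_term_has_sum[of 1 w] has_sum_unique by auto
qed

lemma appell_m_Phi:
  assumes "x \<noteq> 0" "z \<noteq> 0" "\<And>r::int. 1 - q powi (r - 1) * x * z \<noteq> 0"
  shows "jtheta (x * z) q * appell_m x q z = - z * Phi (x * z) (z ^ 2 * x) / jtheta z q"
proof -
  define y where "y = x * z"
  have y: "y \<noteq> 0" using assms by (simp add: y_def)
  let ?t = "\<lambda>r. (-1) powi r * q powi (r * (r - 1) div 2) * z powi r / (1 - q powi (r - 1) * x * z)"
  \<comment> \<open>The shift \<open>r = s + 1\<close> makes the denominator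
    \<open>1 - q powi s * y\<close>. The exponents \<open>tri (s + 1)\<close> of the sum and
    \<open>tri s\<close> of the quasi-periodicity add up to \<open>s * s\<close>, the square in
    \<open>phi_term\<close>.\<close>
  have "jtheta y q * ?t (s + 1) = - z * phi_term y (z ^ 2 * x) s" for s
  proof -
    have nz: "1 - q powi s * y \<noteq> 0"
      using assms(3)[of "s + 1"] by (simp add: y_def mult_ac)
    have "jtheta y q * ?t (s + 1) =
            ((-1) powi s * q powi (tri s) * y powi s * jtheta (q powi s * y) q) *
            ((-1) powi (s + 1) * q powi (tri (s + 1)) * z powi (s + 1) / (1 - q powi s * y))"
      unfolding jtheta_powi_mult[OF y] by (simp add: tri_def y_def mult_ac)
    also have "\<dots> = - z * ((q powi (tri (s + 1)) * q powi tri s) * (y powi s * z powi s) * psi (q powi s * y))"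
      unfolding jtheta_psi using nz assms by (simp add: power_int_add)
    also note q_powi_tri(2)
    also have "y powi s * z powi s = (z ^ 2 * x) powi s"
    proof -
      have "z ^ 2 * x = y * z" by (simp add: y_def power2_eq_square)
      thus ?thesis by (simp only: power_int_mult_distrib)
    qed
    finally show ?thesis by (simp add: phi_term_def)
  qed
  hence "((\<lambda>s. jtheta y q * ?t (s + 1)) has_sum (- z * Phi y (z ^ 2 * x))) UNIV"
    using has_sum_cmult_right[OF phi_term_has_sum[OF y], of "- z"] by (simp only:)
  hence "((\<lambda>r. jtheta y q * ?t r) has_sum (- z * Phi y (z ^ 2 * x))) UNIV"
    by (subst has_sum_reindex_bij_witness[of _ "\<lambda>s. s + 1" "\<lambda>s. s - 1" UNIV
          "\<lambda>s. jtheta y q * ?t (s + 1)"]) auto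
  hence "jtheta y q * (\<Sum>\<^sub>\<infinity>r. ?t r) = - z * Phi y (z ^ 2 * x)"
    by (subst infsum_cmult_right' [symmetric]) (rule infsumI)
  moreover have "jtheta y q * appell_m x q z = jtheta y q * (\<Sum>\<^sub>\<infinity>r. ?t r) / jtheta z q"
    by (simp only: appell_m_def times_divide_eq_left mult_1_left times_divide_eq_right)
  ultimately show ?thesis
    unfolding y_def by (simp only:)
qed

section \<open>The second equation\<close>

text \<open>For large \<open>x\<close> the multiplier \<open>c x^k\<close> has modulus at least 1
  and \<open>norm (f x) <= norm (f (q x))\<close>; for small \<open>x\<close> the inequality is
  reversed. Either way the values are controlled by those on a compact annulus. The equation is
  asked for only on an open set, so that zeros of denominators can be avoided.\<close>

lemma quasi_periodic_eq_0:
  assumes hol: "f holomorphic_on -{0}"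
    and U: "open U" "U \<noteq> {}" "U \<subseteq> -{0}"
    and eq: "\<And>x. x \<in> U \<Longrightarrow> f (q * x) = c * x ^ k * f x"
    and k: "k > 0" and c: "c \<noteq> 0" and x: "x \<noteq> 0"
  shows "f x = 0"
proof -
  have feq: "f (q * x) = c * x ^ k * f x" if "x \<noteq> 0" for x
  proof (rule analytic_continuation_open[OF U(1) _ U(2) _ U(3), where z = x])
    show "connected (-{0::complex})"
      by (rule connected_punctured_universe) simp
    have "(f \<circ> (\<lambda>x. q * x)) holomorphic_on -{0}"
      by (rule holomorphic_on_compose_gen[OF _ hol]) (auto intro!: holomorphic_intros)
    thus "(\<lambda>x. f (q * x)) holomorphic_on -{0}" by (simp add: o_def)
    show "(\<lambda>x. c * x ^ k * f x) holomorphic_on -{0}"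
      by (intro holomorphic_intros hol)
  qed (use that eq in auto)
  define r where "r = norm q"
  have r: "r > 0" "r < 1" using q_lt_1 by (auto simp: r_def)
  \<comment> \<open>The multiplier has modulus at least 1 beyond \<rho> and at most 1 below
    \<delta>. The annulus \<open>A\<close> reaches down to \<open>r * \<delta>\<close>, so that a
    step of ratio \<open>r\<close> cannot jump over it.\<close>
  define \<rho> where "\<rho> = max 1 (1 / norm c)"
  define \<delta> where "\<delta> = min 1 (1 / norm c)"
  have \<rho>: "\<rho> \<ge> 1" "\<rho> \<ge> 1 / norm c" and \<delta>: "\<delta> > 0" "\<delta> \<le> 1" "\<delta> \<le> 1 / norm c"
    using c by (auto simp: \<rho>_def \<delta>_def)
  define A where "A = {x::complex. r * \<delta> \<le> norm x} \<inter> cball 0 \<rho>"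
  have "compact A"
    unfolding A_def by (intro closed_Int_compact closed_Collect_le continuous_intros compact_cball)
  moreover have "A \<subseteq> -{0}"
    using mult_pos_pos[OF r(1) \<delta>(1)] by (auto simp: A_def)
  ultimately have "compact (f ` A)"
    using holomorphic_on_imp_continuous_on[OF holomorphic_on_subset[OF hol]]
      compact_continuous_image by blast
  hence "bounded (f ` A)" by (rule compact_imp_bounded)
  then obtain M where M: "\<And>x. x \<in> A \<Longrightarrow> norm (f x) \<le> M"
    unfolding bounded_iff by blast
  have big: "norm (f x) \<le> M" if "\<rho> \<le> norm x" "norm x * r ^ n \<le> \<rho>" for x n
    using that
  proof (induction n arbitrary: x)
    case 0
    have "r * \<delta> \<le> 1" using r \<delta> mult_mono[of r 1 \<delta> 1] by simp
    thus ?case using 0 \<rho> by (intro M) (auto simp: A_def)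
  next
    case (Suc n)
    have x: "x \<noteq> 0" using Suc.prems \<rho> by auto
    have nqx: "norm (q * x) = r * norm x" by (simp add: norm_mult r_def)
    have "norm (f (q * x)) \<le> M"
    proof (cases "norm (q * x) \<ge> \<rho>")
      case True
      thus ?thesis
        using Suc.prems by (intro Suc.IH) (auto simp: nqx mult_ac)
    next
      case False
      have "r * \<delta> \<le> r * norm x"
        using Suc.prems r \<delta> \<rho> by (intro mult_left_mono) auto
      thus ?thesis using False by (intro M) (auto simp: A_def nqx)
    qed
    moreover have "1 \<le> norm c * norm x ^ k"
    proof -
      have "1 = norm c * (1 / norm c)" using c by simp
      also have "\<dots> \<le> norm c * norm x"
        using Suc.prems \<rho> by (intro mult_left_mono) auto
      also have "norm x \<le> norm x ^ k"
        using Suc.prems \<rho> k by (intro self_le_power) auto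
      finally show ?thesis by (simp add: mult_left_mono)
    qed
    hence "norm (f x) \<le> norm (f (q * x))"
      unfolding feq[OF x] norm_mult norm_power
      using mult_right_mono[of 1 "norm c * norm x ^ k" "norm (f x)"] by simp
    ultimately show ?case by linarith
  qed
  have small: "norm (f x) \<le> M" if "norm x \<le> \<delta>" "\<delta> * r ^ Suc n \<le> norm x" for x n
    using that
  proof (induction n arbitrary: x)
    case 0
    thus ?case using \<delta> \<rho> by (intro M) (auto simp: A_def mult_ac)
  next
    case (Suc n)
    have "\<delta> * r ^ Suc (Suc n) > 0" using r \<delta> by (intro mult_pos_pos zero_less_power)
    hence "x \<noteq> 0" using Suc.prems by auto
    show ?case
    proof (cases "norm x \<ge> r * \<delta>")
      case True
      thus ?thesis using Suc.prems \<delta> \<rho> by (intro M) (auto simp: A_def)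
    next
      case False
      define y where "y = x / q"
      have y: "y \<noteq> 0" "x = q * y" using \<open>x \<noteq> 0\<close> by (auto simp: y_def)
      have ny: "norm x = r * norm y" by (simp add: y norm_mult r_def)
      have y_le: "norm y \<le> \<delta>" using False r by (simp add: ny)
      have "r * (\<delta> * r ^ Suc n) \<le> r * norm y"
        using Suc.prems by (simp add: ny mult_ac)
      hence "\<delta> * r ^ Suc n \<le> norm y"
        using r by (simp only: mult_le_cancel_left_pos)
      hence *: "norm (f y) \<le> M"
        using y_le by (intro Suc.IH)
      have "norm c * norm y ^ k \<le> norm c * norm y ^ 1"
        using y_le \<delta> k by (intro mult_left_mono power_decreasing) auto
      also have "norm c * norm y ^ 1 \<le> norm c * (1 / norm c)"
        using y_le \<delta> by (intro mult_left_mono) auto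
      also have "\<dots> = 1" using c by simp
      finally have "norm (f x) \<le> norm (f y)"
        unfolding y(2) feq[OF y(1)] norm_mult norm_power
        using mult_right_mono[of "norm c * norm y ^ k" 1 "norm (f y)"] by simp
      thus ?thesis using * by linarith
    qed
  qed
  have pow: "\<exists>n. C * r ^ n \<le> \<epsilon>" if "\<epsilon> > 0" for C \<epsilon> :: real
  proof -
    have "(\<lambda>n. C * r ^ n) \<longlonglongrightarrow> 0"
      using r by (intro tendsto_mult_right_zero LIMSEQ_power_zero) auto
    hence "eventually (\<lambda>n. C * r ^ n < \<epsilon>) sequentially"
      using that by (rule order_tendstoD)
    thus ?thesis
      unfolding eventually_sequentially by (meson less_imp_le order_refl)
  qed
  have bound: "norm (f x) \<le> M" if "x \<noteq> 0" for x
  proof -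
    consider "norm x \<ge> \<rho>" | "norm x \<le> \<delta>" | "\<delta> \<le> norm x" "norm x \<le> \<rho>" by linarith
    thus ?thesis
    proof cases
      case 1
      thus ?thesis using pow[of \<rho> "norm x"] \<rho> big by force
    next
      case 2
      obtain n where "\<delta> * r * r ^ n \<le> norm x"
        using pow[of "norm x" "\<delta> * r"] \<open>x \<noteq> 0\<close> by auto
      thus ?thesis using 2 small[of x n] by (simp add: mult_ac)
    next
      case 3
      have "r * \<delta> \<le> 1 * \<delta>" using r \<delta> by (intro mult_right_mono) auto
      thus ?thesis using 3 by (intro M) (auto simp: A_def)
    qed
  qed
  have "\<exists>g. g holomorphic_on UNIV \<and> (\<forall>z\<in>UNIV - {0}. g z = f z)"
    using hol bound
    by (subst holomorphic_on_extend_bounded)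
       (auto simp: Compl_eq_Diff_UNIV eventually_at_filter intro!: exI[of _ M] always_eventually)
  then obtain g where g: "g holomorphic_on UNIV" "\<And>z. z \<noteq> 0 \<Longrightarrow> g z = f z" by auto
  have "norm (g z) \<le> max M (norm (g 0))" for z
    using bound[of z] g(2)[of z] by (cases "z = 0") auto
  hence "bounded (range g)"
    unfolding bounded_iff by blast
  with g(1) have "g constant_on UNIV" by (rule Liouville_theorem)
  then obtain C where C: "\<And>z. g z = C" unfolding constant_on_def by auto
  have fC: "f z = C" if "z \<noteq> 0" for z using g(2)[OF that] C by simp
  \<comment> \<open>Otherwise \<open>c z^k = 1\<close> for every nonzero \<open>z\<close>; the
    points 1 and 2 contradict this.\<close>
  have "C = 0"
  proof (rule ccontr)
    assume "C \<noteq> 0"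
    have "c * z ^ k = 1" if "z \<noteq> 0" for z
      using feq[OF that] that \<open>C \<noteq> 0\<close> by (simp add: fC)
    from this[of 1] this[of 2] have "(2::complex) ^ k = 1" by simp
    hence "norm ((2::complex) ^ k) = 1" by simp
    hence "(2::real) ^ k = 1" by (simp add: norm_power)
    thus False using one_less_power[of "2 :: real" k] k by simp
  qed
  thus ?thesis using fC x by simp
qed

lemma summable_q_power:
  assumes "\<And>n. norm (f n) \<le> C" "\<And>n. n \<le> e n"
  shows "summable (\<lambda>n. norm (q ^ e n * f n))"
proof (rule summable_comparison_test)
  have C: "C \<ge> 0" using assms(1)[of 0] norm_ge_zero order_trans by blast
  have "norm (q ^ e n * f n) \<le> norm q ^ n * C" for n
    unfolding norm_mult norm_power using q_lt_1 assms C
    by (intro mult_mono power_decreasing) auto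
  thus "\<exists>N. \<forall>n\<ge>N. norm (norm (q ^ e n * f n)) \<le> norm q ^ n * C" by auto
  show "summable (\<lambda>n. norm q ^ n * C)"
    using q_lt_1 by (intro summable_mult2 summable_geometric) auto
qed

text \<open>In base \<open>q^2\<close> and at \<open>x = -a q\<close>, the general term of the
  theorem is \<open>q\<close> times this one.\<close>

definition F_term :: "complex \<Rightarrow> nat \<Rightarrow> complex" where
  "F_term x n = q ^ n * qpoch x q n * qpoch (q / x) q n"

text \<open>An unordered sum, as \<open>holomorphic_infsum_punctured\<close> requires;
  \<open>F_sums\<close> recovers the series.\<close>

definition F_sum :: "complex \<Rightarrow> complex" where
  "F_sum x = (\<Sum>\<^sub>\<infinity>n. F_term x n)"

lemma norm_qpoch_mult_le:
  assumes "norm x \<le> R" "norm y \<le> R"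
  shows "norm (qpoch x q n * qpoch y q n) \<le> exp (R / (1 - norm q)) ^ 2"
  unfolding norm_mult power2_eq_square by (intro mult_mono norm_qpoch_le assms) auto

lemma summable_q_qpoch:
  assumes "\<And>n. n \<le> e n"
  shows "summable (\<lambda>n. norm (q ^ e n * (qpoch x q n * qpoch y q n)))"
  by (rule summable_q_power[OF norm_qpoch_mult_le[of x "max (norm x) (norm y)" y] assms]) auto

lemma F_sums: "F_term x sums F_sum x"
proof -
  have s: "summable (\<lambda>n. norm (F_term x n))"
    unfolding F_term_def mult.assoc by (rule summable_q_qpoch) auto
  have "(F_term x has_sum suminf (F_term x)) UNIV"
    by (rule norm_summable_imp_has_sum[OF s summable_sums[OF summable_norm_cancel[OF s]]])
  thus ?thesis
    unfolding F_sum_def using has_sum_imp_sums by (simp add: infsumI)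
qed

lemma F_sum_holomorphic: "F_sum holomorphic_on -{0}"
  unfolding F_sum_def
proof (rule holomorphic_infsum_punctured)
  show "(\<lambda>x. F_term x n) holomorphic_on -{0}" for n
    unfolding F_term_def qpoch_def by (intro holomorphic_intros) auto
next
  fix R :: real
  define B where "B = exp (R / (1 - norm q)) ^ 2"
  show "\<exists>M. M summable_on UNIV \<and> (\<forall>x n. x \<noteq> 0 \<longrightarrow> norm x \<le> R \<longrightarrow> norm (1 / x) \<le> R \<longrightarrow>
              norm (F_term x n) \<le> M n)"
  proof (intro exI[of _ "\<lambda>n. norm q ^ n * B"] conjI allI impI)
    show "(\<lambda>n. norm q ^ n * B) summable_on UNIV"
      using q_lt_1
      by (auto simp: summable_on_UNIV_nonneg_real_iff B_def intro!: summable_mult2 summable_geometric)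
  next
    fix x :: complex and n :: nat
    assume x: "x \<noteq> 0" "norm x \<le> R" "norm (1 / x) \<le> R"
    have "norm (q / x) \<le> norm (1 / x)"
      using q_lt_1 by (simp add: norm_divide divide_right_mono)
    hence "norm (qpoch x q n * qpoch (q / x) q n) \<le> B"
      unfolding B_def using x by (intro norm_qpoch_mult_le) auto
    thus "norm (F_term x n) \<le> norm q ^ n * B"
      unfolding F_term_def mult.assoc norm_mult[of "q ^ n"] norm_power by (rule mult_left_mono) simp
  qed
qed

text \<open>Both \<open>F(x)\<close> and \<open>F(q x)\<close> are combinations of \<open>\<Sum> q\<^sup>n p(n)\<close> and \<open>\<Sum> q\<^bsup>2n\<^esup> p(n)\<close> for
  \<open>p(n) = (x;q)\<^sub>n (1/x;q)\<^sub>n\<close>, and telescoping \<open>p(n+1) - p(n)\<close> gives a linear relation between these two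
  sums. The equation for \<open>g\<close> is proved in the same way from \<open>e(n) - e(n+1)\<close>.\<close>

lemma F_sum_q_mult:
  assumes x: "x \<noteq> 0" "x \<noteq> 1"
  shows "F_sum (q * x) + x ^ 3 * F_sum x =
           (1 - x ^ 2) * (qpoch_inf x q * qpoch_inf (q / x) q) + x + x ^ 2"
proof -
  define y where "y = 1 / x"
  have xy: "x * y = 1" using x by (simp add: y_def)
  have q_double: "q ^ (2 * n) = q ^ n * q ^ n" for n
    by (simp add: mult_2 power_add)
  define p where "p = (\<lambda>n. qpoch x q n * qpoch y q n)"
  define T where "T = qpoch_inf x q * qpoch_inf (q / x) q"
  define B1 B2 where "B1 = (\<Sum>n. q ^ n * p n)" and "B2 = (\<Sum>n. q ^ (2 * n) * p n)"
  have B1: "(\<lambda>n. q ^ n * p n) sums B1"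
    unfolding B1_def p_def by (rule summable_sums, rule summable_norm_cancel, rule summable_q_qpoch) auto
  have B2: "(\<lambda>n. q ^ (2 * n) * p n) sums B2"
    unfolding B2_def p_def by (rule summable_sums, rule summable_norm_cancel, rule summable_q_qpoch) auto
  have "p \<longlonglongrightarrow> qpoch_inf x q * qpoch_inf y q"
    unfolding p_def by (intro tendsto_intros qpoch_tendsto)
  also have "qpoch_inf y q = (1 - y) * qpoch_inf (q / x) q"
    by (subst qpoch_inf_shift) (simp add: y_def)
  finally have "(\<lambda>n. p (Suc n) - p n) sums (qpoch_inf x q * ((1 - y) * qpoch_inf (q / x) q) - p 0)"
    by (rule telescope_sums)
  also have "(\<lambda>n. p (Suc n) - p n) = (\<lambda>n. q ^ (2 * n) * p n - (x + y) * (q ^ n * p n))"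
  proof
    fix n
    \<comment> \<open>As \<open>x y = 1\<close>, the new factors multiply to
      \<open>1 - (x + y) q^n + q^(2n)\<close>.\<close>
    have "p (Suc n) = p n * (1 - (x + y) * q ^ n + (x * y) * (q ^ n * q ^ n))"
      by (simp add: p_def qpoch_Suc algebra_simps)
    thus "p (Suc n) - p n = q ^ (2 * n) * p n - (x + y) * (q ^ n * p n)"
      unfolding q_double by (simp add: xy algebra_simps)
  qed
  finally have "(\<lambda>n. q ^ (2 * n) * p n - (x + y) * (q ^ n * p n)) sums ((1 - y) * T - 1)"
    by (simp add: T_def p_def mult_ac)
  moreover have "(\<lambda>n. q ^ (2 * n) * p n - (x + y) * (q ^ n * p n)) sums (B2 - (x + y) * B1)"
    by (intro sums_diff sums_mult B1 B2)
  ultimately have e1: "B2 - (x + y) * B1 = (1 - y) * T - 1"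
    by (rule sums_unique2[symmetric])
  have "(\<lambda>n. (1 - y) * F_term x n) = (\<lambda>n. q ^ n * p n - y * (q ^ (2 * n) * p n))"
  proof
    fix n
    have "(1 - y) * qpoch (q / x) q n = qpoch y q (Suc n)"
      unfolding qpoch_Suc_shift by (simp add: y_def)
    also have "\<dots> = qpoch y q n * (1 - y * q ^ n)" by (rule qpoch_Suc)
    finally have *: "(1 - y) * qpoch (q / x) q n = qpoch y q n * (1 - y * q ^ n)" .
    have "(1 - y) * F_term x n = q ^ n * qpoch x q n * ((1 - y) * qpoch (q / x) q n)"
      by (simp add: F_term_def)
    also have "\<dots> = q ^ n * p n - y * (q ^ (2 * n) * p n)"
      unfolding * q_double by (simp add: p_def algebra_simps)
    finally show "(1 - y) * F_term x n = q ^ n * p n - y * (q ^ (2 * n) * p n)" .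
  qed
  moreover have "(\<lambda>n. (1 - y) * F_term x n) sums ((1 - y) * F_sum x)"
    by (intro sums_mult F_sums)
  moreover have "(\<lambda>n. q ^ n * p n - y * (q ^ (2 * n) * p n)) sums (B1 - y * B2)"
    by (intro sums_diff sums_mult B1 B2)
  ultimately have e2: "(1 - y) * F_sum x = B1 - y * B2"
    using sums_unique2 by metis
  have "(\<lambda>n. (1 - x) * F_term (q * x) n) = (\<lambda>n. q ^ n * p n - x * (q ^ (2 * n) * p n))"
  proof
    fix n
    have "(1 - x) * qpoch (q * x) q n = qpoch x q (Suc n)"
      unfolding qpoch_Suc_shift by (simp add: mult_ac)
    also have "\<dots> = qpoch x q n * (1 - x * q ^ n)" by (rule qpoch_Suc)
    finally have *: "(1 - x) * qpoch (q * x) q n = qpoch x q n * (1 - x * q ^ n)" .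
    have "(1 - x) * F_term (q * x) n = q ^ n * ((1 - x) * qpoch (q * x) q n) * qpoch y q n"
      by (simp add: F_term_def y_def)
    also have "\<dots> = q ^ n * p n - x * (q ^ (2 * n) * p n)"
      unfolding * q_double by (simp add: p_def algebra_simps)
    finally show "(1 - x) * F_term (q * x) n = q ^ n * p n - x * (q ^ (2 * n) * p n)" .
  qed
  moreover have "(\<lambda>n. (1 - x) * F_term (q * x) n) sums ((1 - x) * F_sum (q * x))"
    by (intro sums_mult F_sums)
  moreover have "(\<lambda>n. q ^ n * p n - x * (q ^ (2 * n) * p n)) sums (B1 - x * B2)"
    by (intro sums_diff sums_mult B1 B2)
  ultimately have e3: "(1 - x) * F_sum (q * x) = B1 - x * B2"
    using sums_unique2 by metis
  \<comment> \<open>The weight \<open>x^3\<close> makes \<open>B1\<close> and \<open>B2\<close>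
    enter only as \<open>x^3 - x\<close> times the left side of \<open>e1\<close>, which eliminates
    both.\<close>
  have "(1 - x) * (F_sum (q * x) + x ^ 3 * F_sum x) = (1 - x) * ((1 - x ^ 2) * T + x + x ^ 2)"
    using xy e1 e2 e3 by algebra
  thus ?thesis using x by (simp add: T_def)
qed

lemma jtheta_nzD:
  assumes "x \<noteq> 0" "jtheta x q \<noteq> 0"
  shows "qpoch_inf x q \<noteq> 0" "qpoch_inf (q / x) q \<noteq> 0" "x \<noteq> 1" "qpoch_inf (1 / x) q \<noteq> 0"
        "qpoch_inf (q * x) q \<noteq> 0"
proof -
  show 1: "qpoch_inf x q \<noteq> 0" "qpoch_inf (q / x) q \<noteq> 0" "x \<noteq> 1"
    using assms by (auto simp: jtheta_def)
  show "qpoch_inf (1 / x) q \<noteq> 0"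
    using 1 assms by (subst qpoch_inf_shift) simp
  show "qpoch_inf (q * x) q \<noteq> 0"
    using 1(1) qpoch_inf_shift[of x] by (auto simp: mult_ac)
qed

lemma qpoch_nz: "qpoch_inf x q \<noteq> 0 \<Longrightarrow> qpoch x q n \<noteq> 0"
  using qpoch_inf_split[of x n] by auto

lemma inverse_qpoch_bounded:
  assumes "qpoch_inf x q \<noteq> 0"
  shows "\<exists>C. \<forall>n. norm (1 / qpoch x q n) \<le> C"
proof -
  have "(\<lambda>n. 1 / qpoch x q n) \<longlonglongrightarrow> 1 / qpoch_inf x q"
    using assms by (intro tendsto_intros qpoch_tendsto) auto
  hence "Bseq (\<lambda>n. 1 / qpoch x q n)"
    using convergent_imp_Bseq convergentI by blast
  thus ?thesis unfolding Bseq_def by blast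
qed

lemma summable_q_inverse_qpoch:
  assumes "qpoch_inf x q \<noteq> 0" "qpoch_inf y q \<noteq> 0" "\<And>n. n \<le> e n"
  shows "summable (\<lambda>n. norm (q ^ e n / (qpoch x q (k n) * qpoch y q (l n))))"
proof -
  obtain C where C: "\<And>n. norm (1 / qpoch x q n) \<le> C"
    using inverse_qpoch_bounded[OF assms(1)] by blast
  obtain D where D: "\<And>n. norm (1 / qpoch y q n) \<le> D"
    using inverse_qpoch_bounded[OF assms(2)] by blast
  have CD: "C \<ge> 0" using C[of 0] norm_ge_zero order_trans by blast
  have "norm ((1 / qpoch x q (k n)) * (1 / qpoch y q (l n))) \<le> C * D" for n
    unfolding norm_mult by (intro mult_mono C D CD) auto
  from summable_q_power[of "\<lambda>n. (1 / qpoch x q (k n)) * (1 / qpoch y q (l n))", OF this assms(3)]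
  show ?thesis by simp
qed

text \<open>The symmetric series for \<open>g\<close>, invariant under \<open>x -> q/x\<close>,
  without the \<open>-1\<close> and the prefactor \<open>1/x\<close> of the definition.\<close>

definition G_term :: "complex \<Rightarrow> nat \<Rightarrow> complex" where
  "G_term x n = q ^ (n * n + n) / (qpoch x q (Suc n) * qpoch (q / x) q (Suc n))"

definition G_sum :: "complex \<Rightarrow> complex" where
  "G_sum x = (\<Sum>n. G_term x n)"

lemma G_sums:
  assumes "x \<noteq> 0" "jtheta x q \<noteq> 0"
  shows "G_term x sums G_sum x"
  unfolding G_sum_def G_term_def
  by (rule summable_sums, rule summable_norm_cancel, rule summable_q_inverse_qpoch)
     (use jtheta_nzD[OF assms] in auto)

text \<open>The two series differ by a telescoping one,
  \<open>t n - t (n + 1) = u n - x * G_term x n\<close>, and \<open>t 0 = 1\<close> accounts for the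
  \<open>-1\<close> in \<open>mock_g\<close>.\<close>

lemma mock_g_eq_G_sum:
  assumes x: "x \<noteq> 0" "jtheta x q \<noteq> 0"
  shows "mock_g x q = G_sum x"
proof -
  define t where "t = (\<lambda>n. q ^ (n * n) / (qpoch x q n * qpoch (q / x) q n))"
  define u where "u = (\<lambda>n. q ^ (n\<^sup>2) / (qpoch x q (n + 1) * qpoch (q / x) q n))"
  have "summable (\<lambda>n. norm (t n))"
    unfolding t_def by (rule summable_q_inverse_qpoch) (use jtheta_nzD[OF x] in auto)
  hence "t \<longlonglongrightarrow> 0"
    by (rule summable_LIMSEQ_zero[OF summable_norm_cancel])
  hence "(\<lambda>n. t n - t (Suc n)) sums (t 0 - 0)"
    by (rule telescope_sums')
  also have "(\<lambda>n. t n - t (Suc n)) = (\<lambda>n. u n - x * G_term x n)"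
  proof
    fix n
    define A B a b where "A = qpoch x q n" and "B = qpoch (q / x) q n"
      and "a = 1 - x * q ^ n" and "b = 1 - q / x * q ^ n"
    have S: "qpoch x q (Suc n) = A * a" "qpoch (q / x) q (Suc n) = B * b"
      by (simp_all add: A_def B_def a_def b_def qpoch_Suc)
    have nz: "A * a \<noteq> 0" "B * b \<noteq> 0"
      using qpoch_nz[OF jtheta_nzD(1)[OF x], of "Suc n"] qpoch_nz[OF jtheta_nzD(2)[OF x], of "Suc n"]
      unfolding S by simp_all
    have "t n = q ^ (n * n) * (a * b) / (A * a * (B * b))"
      using nz by (simp add: t_def A_def B_def)
    moreover have "t (Suc n) = q ^ (n * n) * (q * q ^ n * q ^ n) / (A * a * (B * b))"
      by (simp add: t_def S power_add mult_ac)
    ultimately have "t n - t (Suc n) = q ^ (n * n) * (a * b - q * q ^ n * q ^ n) / (A * a * (B * b))"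
      by (simp add: diff_divide_distrib right_diff_distrib)
    also have "a * b - q * q ^ n * q ^ n = b - x * q ^ n"
      using x by (simp add: a_def b_def field_simps)
    finally have "t n - t (Suc n) =
        q ^ (n * n) * b / (A * a * (B * b)) - x * (q ^ (n * n) * q ^ n / (A * a * (B * b)))"
      by (simp add: diff_divide_distrib right_diff_distrib mult_ac)
    also have "q ^ (n * n) * b / (A * a * (B * b)) = u n"
      using nz by (simp add: u_def S power2_eq_square flip: B_def)
    also have "q ^ (n * n) * q ^ n / (A * a * (B * b)) = G_term x n"
      by (simp add: G_term_def S power_add)
    finally show "t n - t (Suc n) = u n - x * G_term x n" .
  qed
  finally have "(\<lambda>n. u n - x * G_term x n) sums 1"
    by (simp add: t_def)
  hence "(\<lambda>n. u n - x * G_term x n + x * G_term x n) sums (1 + x * G_sum x)"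
    by (intro sums_add sums_mult G_sums x)
  hence "u sums (1 + x * G_sum x)" by simp
  hence "(\<Sum>n. u n) = 1 + x * G_sum x"
    by (simp add: sums_iff)
  thus ?thesis
    using x unfolding mock_g_def u_def by simp
qed

lemma G_sum_q_mult:
  assumes x: "x \<noteq> 0" "jtheta x q \<noteq> 0"
  shows "G_sum (q * x) + x ^ 3 * G_sum x = - x - x ^ 2"
proof -
  define y where "y = 1 / x"
  have xy: "x * y = 1" using x by (simp add: y_def)
  note nz = jtheta_nzD[OF x, folded y_def]
  \<comment> \<open>A common denominator for the terms of \<open>G_sum x\<close> and
    \<open>G_sum (q * x)\<close>: \<open>(1 - y) (q/x;q)_(n+1) = (y;q)_(n+2)\<close>, and
    \<open>(1 - x) (q x;q)_(n+1) = (x;q)_(n+2)\<close>.\<close>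
  define d where "d = (\<lambda>n. q ^ (n * n + n) / (qpoch x q (Suc (Suc n)) * qpoch y q (Suc (Suc n))))"
  define e where "e = (\<lambda>n. q ^ (n * n + n) / (qpoch x q (Suc n) * qpoch y q (Suc n)))"
  define C0 C1 where "C0 = (\<Sum>n. d n)" and "C1 = (\<Sum>n. q ^ n * d n)"
  have d: "summable (\<lambda>n. norm (d n))"
    unfolding d_def by (rule summable_q_inverse_qpoch) (use nz in auto)
  hence C0: "d sums C0"
    unfolding C0_def by (rule summable_sums[OF summable_norm_cancel])
  have "summable (\<lambda>n. norm (q ^ (n + (n * n + n)) / (qpoch x q (Suc (Suc n)) * qpoch y q (Suc (Suc n)))))"
    by (rule summable_q_inverse_qpoch) (use nz in auto)
  hence C1: "(\<lambda>n. q ^ n * d n) sums C1"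
    unfolding C1_def d_def by (intro summable_sums[OF summable_norm_cancel]) (simp add: power_add mult_ac)
  have S: "qpoch x q (Suc (Suc n)) = qpoch x q (Suc n) * (1 - x * q ^ Suc n)"
          "qpoch y q (Suc (Suc n)) = qpoch y q (Suc n) * (1 - y * q ^ Suc n)" for n
    by (rule qpoch_Suc)+
  have snz: "qpoch x q n \<noteq> 0" "qpoch y q n \<noteq> 0" for n
    using nz qpoch_nz by blast+
  have snz': "1 - x * q ^ Suc n \<noteq> 0" "1 - y * q ^ Suc n \<noteq> 0" for n
    using snz[of "Suc (Suc n)"] unfolding S by auto
  have e_eq: "e n = q ^ (n * n + n) * ((1 - x * q ^ Suc n) * (1 - y * q ^ Suc n)) /
                      (qpoch x q (Suc (Suc n)) * qpoch y q (Suc (Suc n)))" for n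
    unfolding e_def S using snz[of "Suc n"] snz'[of n] by simp
  have "summable (\<lambda>n. norm (e n))"
    unfolding e_def by (rule summable_q_inverse_qpoch) (use nz in auto)
  hence "e \<longlonglongrightarrow> 0"
    by (rule summable_LIMSEQ_zero[OF summable_norm_cancel])
  hence "(\<lambda>n. e n - e (Suc n)) sums (e 0 - 0)"
    by (rule telescope_sums')
  also have "(\<lambda>n. e n - e (Suc n)) = (\<lambda>n. d n - (x + y) * q * (q ^ n * d n))"
  proof
    fix n
    have "e (Suc n) = q ^ (n * n + n) * (q ^ Suc n * q ^ Suc n) /
                       (qpoch x q (Suc (Suc n)) * qpoch y q (Suc (Suc n)))"
      by (simp add: e_def power_add mult_ac)
    with e_eq[of n]
    have "e n - e (Suc n) = d n * ((1 - x * q ^ Suc n) * (1 - y * q ^ Suc n) - q ^ Suc n * q ^ Suc n)"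
      by (simp only: d_def times_divide_eq_left diff_divide_distrib right_diff_distrib)
    also have "(1 - x * q ^ Suc n) * (1 - y * q ^ Suc n) - q ^ Suc n * q ^ Suc n =
                 1 - (x + y) * q ^ Suc n + (x * y - 1) * (q ^ Suc n * q ^ Suc n)"
      by (simp add: algebra_simps)
    finally show "e n - e (Suc n) = d n - (x + y) * q * (q ^ n * d n)"
      by (simp add: xy algebra_simps)
  qed
  finally have "(\<lambda>n. d n - (x + y) * q * (q ^ n * d n)) sums e 0" by simp
  moreover have "(\<lambda>n. d n - (x + y) * q * (q ^ n * d n)) sums (C0 - (x + y) * q * C1)"
    by (intro sums_diff sums_mult C0 C1)
  ultimately have "C0 - (x + y) * q * C1 = e 0"
    by (rule sums_unique2[symmetric])
  also have "e 0 = 1 / ((1 - x) * (1 - y))"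
    by (simp add: e_def qpoch_Suc)
  finally have e1: "(1 - x) * (1 - y) * (C0 - (x + y) * q * C1) = 1"
    using snz[of 1] by (simp add: qpoch_Suc)
  have "G_term x n = (1 - y) * (d n - x * q * (q ^ n * d n))" for n
  proof -
    have *: "(1 - y) * qpoch (q / x) q (Suc n) = qpoch y q (Suc (Suc n))"
      unfolding qpoch_Suc_shift[of y "Suc n"] by (simp add: y_def)
    have "1 - y \<noteq> 0" using snz[of 1] by (simp add: qpoch_Suc)
    hence "G_term x n = (1 - y) * q ^ (n * n + n) * (1 - x * q ^ Suc n) /
             ((qpoch x q (Suc n) * (1 - x * q ^ Suc n)) * ((1 - y) * qpoch (q / x) q (Suc n)))"
      unfolding G_term_def using snz'[of n] by simp
    also have "\<dots> = (1 - y) * (d n - x * q * (q ^ n * d n))"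
      unfolding * S(1)[symmetric] d_def
      by (simp add: algebra_simps diff_divide_distrib add_divide_distrib)
    finally show ?thesis .
  qed
  hence "G_term x = (\<lambda>n. (1 - y) * (d n - x * q * (q ^ n * d n)))" by auto
  moreover have "(\<lambda>n. (1 - y) * (d n - x * q * (q ^ n * d n))) sums ((1 - y) * (C0 - x * q * C1))"
    by (intro sums_diff sums_mult C0 C1)
  ultimately have e2: "G_sum x = (1 - y) * (C0 - x * q * C1)"
    unfolding G_sum_def by (simp add: sums_iff)
  have "G_term (q * x) n = (1 - x) * (d n - y * q * (q ^ n * d n))" for n
  proof -
    have *: "(1 - x) * qpoch (q * x) q (Suc n) = qpoch x q (Suc (Suc n))"
      unfolding qpoch_Suc_shift[of x "Suc n"] by (simp add: mult_ac)
    have "1 - x \<noteq> 0" using snz[of 1] by (simp add: qpoch_Suc)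
    moreover have "G_term (q * x) n = q ^ (n * n + n) / (qpoch (q * x) q (Suc n) * qpoch y q (Suc n))"
      using x by (simp add: G_term_def y_def)
    ultimately have "G_term (q * x) n = (1 - x) * q ^ (n * n + n) * (1 - y * q ^ Suc n) /
             (((1 - x) * qpoch (q * x) q (Suc n)) * (qpoch y q (Suc n) * (1 - y * q ^ Suc n)))"
      using snz'[of n] by simp
    also have "\<dots> = (1 - x) * (d n - y * q * (q ^ n * d n))"
      unfolding * S(2)[symmetric] d_def
      by (simp add: algebra_simps diff_divide_distrib add_divide_distrib)
    finally show ?thesis .
  qed
  hence "G_term (q * x) = (\<lambda>n. (1 - x) * (d n - y * q * (q ^ n * d n)))" by auto
  moreover have "(\<lambda>n. (1 - x) * (d n - y * q * (q ^ n * d n))) sums ((1 - x) * (C0 - y * q * C1))"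
    by (intro sums_diff sums_mult C0 C1)
  ultimately have e3: "G_sum (q * x) = (1 - x) * (C0 - y * q * C1)"
    unfolding G_sum_def by (simp add: sums_iff)
  \<comment> \<open>The weight \<open>x^3\<close> leaves
    \<open>(1 - x)(1 - x^2)(C0 - (x + y) q C1)\<close>, which by \<open>e1\<close> equals
    \<open>(1 - x^2)/(1 - y) = -x - x^2\<close>.\<close>
  show ?thesis
    using xy e1 e2 e3 by algebra
qed

text \<open>\<open>H_sum\<close> is \<open>(x;q)\<^bsub>\<infinity>\<^esub> (q/x;q)\<^bsub>\<infinity>\<^esub> g(x)\<close> with the denominators cancelled, hence free of poles.\<close>

definition H_term :: "complex \<Rightarrow> nat \<Rightarrow> complex" where
  "H_term x n = q ^ (n * n + n) * (qpoch_inf (x * q ^ Suc n) q * qpoch_inf (q / x * q ^ Suc n) q)"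

definition H_sum :: "complex \<Rightarrow> complex" where
  "H_sum x = (\<Sum>\<^sub>\<infinity>n. H_term x n)"

lemma norm_H_term_le:
  assumes x: "x \<noteq> 0" "norm x \<le> R" "norm (1 / x) \<le> R"
  shows "norm (H_term x n) \<le> norm q ^ n * exp (R / (1 - norm q)) ^ 2"
proof -
  have le: "norm (c * q ^ k) \<le> norm c" for c k
    using q_lt_1 mult_left_le[of "norm q ^ k" "norm c"]
    by (auto simp: norm_mult norm_power power_le_one)
  have "norm (q / x) \<le> norm (1 / x)"
    using q_lt_1 by (simp add: norm_divide divide_right_mono)
  hence "norm (qpoch_inf (x * q ^ Suc n) q) \<le> exp (R / (1 - norm q))"
        "norm (qpoch_inf (q / x * q ^ Suc n) q) \<le> exp (R / (1 - norm q))"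
    using x le[of x "Suc n"] le[of "q / x" "Suc n"] by (intro norm_qpoch_inf_le; linarith)+
  thus ?thesis
    unfolding H_term_def norm_mult norm_power power2_eq_square using q_lt_1
    by (intro mult_mono power_decreasing) auto
qed

lemma H_sum_holomorphic: "H_sum holomorphic_on -{0}"
  unfolding H_sum_def
proof (rule holomorphic_infsum_punctured)
  show "(\<lambda>x. H_term x n) holomorphic_on -{0}" for n
    unfolding H_term_def by (intro holomorphic_intros) auto
next
  fix R :: real
  show "\<exists>M. M summable_on UNIV \<and> (\<forall>x n. x \<noteq> 0 \<longrightarrow> norm x \<le> R \<longrightarrow> norm (1 / x) \<le> R \<longrightarrow>
              norm (H_term x n) \<le> M n)"
    using q_lt_1 norm_H_term_le
    by (intro exI[of _ "\<lambda>n. norm q ^ n * exp (R / (1 - norm q)) ^ 2"])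
       (auto simp: summable_on_UNIV_nonneg_real_iff intro!: summable_mult2 summable_geometric)
qed

lemma H_sum_eq:
  assumes x: "x \<noteq> 0" "jtheta x q \<noteq> 0"
  shows "qpoch_inf q q * H_sum x = jtheta x q * G_sum x"
proof -
  define T where "T = qpoch_inf x q * qpoch_inf (q / x) q"
  have *: "H_term x n = T * G_term x n" for n
  proof -
    have "qpoch x q (Suc n) \<noteq> 0" "qpoch (q / x) q (Suc n) \<noteq> 0"
      using jtheta_nzD[OF x] qpoch_nz by blast+
    thus ?thesis
      unfolding T_def H_term_def G_term_def qpoch_inf_split[of x "Suc n"] qpoch_inf_split[of "q / x" "Suc n"]
      by simp
  qed
  have "summable (\<lambda>n. norm (G_term x n))"
    unfolding G_term_def by (rule summable_q_inverse_qpoch) (use jtheta_nzD[OF x] in auto)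
  hence "(G_term x has_sum G_sum x) UNIV"
    by (intro norm_summable_imp_has_sum G_sums x)
  hence "H_sum x = T * G_sum x"
    unfolding H_sum_def * by (intro infsumI has_sum_cmult_right)
  thus ?thesis by (simp add: jtheta_def T_def mult_ac)
qed

text \<open>By \<open>appell_m_Phi\<close> the right side is, up to the factor \<open>-x/q\<close>,
  \<open>j(x) m(x^2/q, q, q/x)\<close> divided by \<open>qpoch_inf q q\<close>.\<close>

lemma F_plus_G:
  assumes x: "x \<noteq> 0" "jtheta x q \<noteq> 0"
  shows "F_sum x + G_sum x = Phi x q / (jtheta x q * qpoch_inf q q)"
proof -
  define P where "P = qpoch_inf q q"
  have P: "P \<noteq> 0" by (simp add: P_def)
  \<comment> \<open>\<open>j(x)\<close> times the difference of the two sides;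
    \<open>P * H_sum x\<close> replaces \<open>j(x) G(x)\<close> to be holomorphic at the theta
    zeros as well.\<close>
  define E where "E = (\<lambda>x. jtheta x q * F_sum x + P * H_sum x - Phi x q / P)"
  \<comment> \<open>Powers of \<open>q\<close> have modulus at most \<open>norm q\<close> or at
    least 1, so this annulus contains no theta zero.\<close>
  define U where "U = {x::complex. norm q < norm x} \<inter> {x. norm x < 1}"
  have U_nz: "x \<noteq> 0" "jtheta x q \<noteq> 0" if "x \<in> U" for x
  proof -
    show x: "x \<noteq> 0" using that by (auto simp: U_def)
    have "x \<noteq> q powi n" for n
    proof
      assume *: "x = q powi n"
      show False
      proof (cases "n \<ge> 1")
        case True
        hence "norm q powi n \<le> norm q powi 1"
          using q_lt_1 by (intro power_int_decreasing) auto
        thus False using that by (simp add: U_def * norm_power_int)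
      next
        case False
        hence "norm q powi 0 \<le> norm q powi n"
          using q_lt_1 by (intro power_int_decreasing) auto
        thus False using that by (simp add: U_def * norm_power_int)
      qed
    qed
    thus "jtheta x q \<noteq> 0"
      using jtheta_eq_0_iff[OF x] by blast
  qed
  have "E x = 0"
  proof (rule quasi_periodic_eq_0[where f = E and x = x and c = 1 and k = 2 and U = U])
    have "(\<lambda>x. Phi (1 * x) (q * x ^ 0)) holomorphic_on -{0}"
      by (rule Phi_holomorphic) auto
    hence "(\<lambda>x. Phi x q) holomorphic_on -{0}" by simp
    thus "E holomorphic_on -{0}"
      unfolding E_def using P
      by (intro holomorphic_intros F_sum_holomorphic H_sum_holomorphic) auto
    show "open U"
      unfolding U_def by (intro open_Int open_Collect_less continuous_intros)
    obtain t where "norm q < t" "t < 1" using dense[OF q_lt_1] by blast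
    moreover from this have "t > 0" using norm_ge_zero[of q] by linarith
    ultimately have "of_real t \<in> U" by (auto simp: U_def)
    thus "U \<noteq> {}" by blast
    show "U \<subseteq> -{0}" by (auto simp: U_def)
    fix x assume "x \<in> U"
    note x = U_nz[OF this]
    have j: "x * jtheta (q * x) q = - jtheta x q"
      using jtheta_q_mult[OF x(1)] x by simp
    have x': "q * x \<noteq> 0" "jtheta (q * x) q \<noteq> 0" using j x by auto
    have x1: "x \<noteq> 1" using jtheta_nzD[OF x] by simp
    define y where "y = 1 / P"
    have Py: "P * y = 1" using P by (simp add: y_def)
    define z where "z = 1 / x"
    have xz: "x * z = 1" using x by (simp add: z_def)
    define T where "T = qpoch_inf x q * qpoch_inf (q / x) q"
    have jT: "jtheta x q = T * P" by (simp add: jtheta_def T_def P_def)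
    have Ex: "E x = jtheta x q * F_sum x + jtheta x q * G_sum x - Phi x q * y"
      unfolding E_def using H_sum_eq[OF x] by (simp add: y_def P_def)
    have Eqx: "E (q * x) = jtheta (q * x) q * F_sum (q * x) + jtheta (q * x) q * G_sum (q * x)
                             - Phi (q * x) q * y"
      unfolding E_def using H_sum_eq[OF x'] by (simp add: y_def P_def)
    have f: "F_sum (q * x) + x ^ 3 * F_sum x = (1 - x ^ 2) * T + x + x ^ 2"
      unfolding T_def by (rule F_sum_q_mult[OF x(1) x1])
    have g: "G_sum (q * x) + x ^ 3 * G_sum x = - x - x ^ 2"
      by (rule G_sum_q_mult[OF x])
    have p: "Phi (q * x) q = x ^ 2 * Phi x q + jtheta x q ^ 2 * (x - z)"
      unfolding z_def by (rule Phi_q_mult_q[OF x(1)])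
    \<comment> \<open>The terms \<open>x + x^2\<close> cancel; the product term is later matched by
      the \<open>x - 1/x\<close> term of \<open>Phi\<close>, since \<open>j = T P\<close>.\<close>
    have FG: "F_sum (q * x) + G_sum (q * x) = - (x ^ 3) * (F_sum x + G_sum x) + (1 - x ^ 2) * T"
      using f g by algebra
    have jq: "jtheta (q * x) q = - z * jtheta x q"
      using j xz by algebra
    have "jtheta (q * x) q * (F_sum (q * x) + G_sum (q * x)) =
             x ^ 2 * jtheta x q * (F_sum x + G_sum x) - z * jtheta x q * ((1 - x ^ 2) * T)"
      unfolding FG jq using xz by algebra
    hence "E (q * x) = x ^ 2 * jtheta x q * (F_sum x + G_sum x) - z * jtheta x q * ((1 - x ^ 2) * T)
                       - (x ^ 2 * Phi x q + jtheta x q ^ 2 * (x - z)) * y"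
      unfolding Eqx p by (simp add: algebra_simps)
    thus "E (q * x) = 1 * x ^ 2 * E x"
      unfolding Ex using jT Py xz by algebra
  qed (use x in auto)
  hence "jtheta x q * (F_sum x + G_sum x) * P = Phi x q"
    unfolding E_def using H_sum_eq[OF x] P by (simp add: P_def field_simps)
  thus ?thesis using x P by (simp add: P_def field_simps)
qed

section \<open>Changing \<open>z\<close> in the Appell--Lerch sum\<close>

lemma qpoch_even_odd: "qpoch x q (2 * n) = qpoch x (q\<^sup>2) n * qpoch (x * q) (q\<^sup>2) n"
proof (induction n)
  case (Suc n)
  have "qpoch x q (2 * Suc n) = qpoch x q (2 * n) * (1 - x * q ^ (2 * n)) * (1 - x * q ^ Suc (2 * n))"
    by (simp add: qpoch_Suc)
  also have "\<dots> = qpoch x (q\<^sup>2) (Suc n) * qpoch (x * q) (q\<^sup>2) (Suc n)"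
    unfolding Suc.IH power_Suc power_mult by (simp add: qpoch_def mult_ac)
  finally show ?case .
qed (simp add: qpoch_def)

lemma nome_square: "nome (q\<^sup>2)"
  using q_lt_1 by unfold_locales (auto simp: norm_power power_less_one_iff)

lemma qpoch_inf_even_odd: "qpoch_inf x q = qpoch_inf x (q\<^sup>2) * qpoch_inf (x * q) (q\<^sup>2)"
proof (rule LIMSEQ_unique)
  interpret sq: nome "q\<^sup>2" by (rule nome_square)
  have "filterlim (\<lambda>n::nat. 2 * n) at_top sequentially"
    by (rule filterlim_subseq) (auto simp: strict_mono_def)
  thus "(\<lambda>n. qpoch x q (2 * n)) \<longlonglongrightarrow> qpoch_inf x q"
    by (rule filterlim_compose[OF qpoch_tendsto])
  show "(\<lambda>n. qpoch x q (2 * n)) \<longlonglongrightarrow> qpoch_inf x (q\<^sup>2) * qpoch_inf (x * q) (q\<^sup>2)"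
    unfolding qpoch_even_odd by (intro tendsto_mult sq.qpoch_tendsto)
qed

lemma qpoch_inf_mult_minus: "qpoch_inf x q * qpoch_inf (- x) q = qpoch_inf (x\<^sup>2) (q\<^sup>2)"
proof (rule LIMSEQ_unique)
  interpret sq: nome "q\<^sup>2" by (rule nome_square)
  show "(\<lambda>n. qpoch x q n * qpoch (- x) q n) \<longlonglongrightarrow> qpoch_inf x q * qpoch_inf (- x) q"
    by (intro tendsto_mult qpoch_tendsto)
  have "qpoch x q n * qpoch (- x) q n = qpoch (x\<^sup>2) (q\<^sup>2) n" for n
    by (induction n) (simp_all add: qpoch_def algebra_simps power2_eq_square power_mult_distrib)
  thus "(\<lambda>n. qpoch x q n * qpoch (- x) q n) \<longlonglongrightarrow> qpoch_inf (x\<^sup>2) (q\<^sup>2)"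
    using sq.qpoch_tendsto by simp
qed

text \<open>The pairs with arguments \<open>s\<close>, \<open>-s\<close> and \<open>q/s\<close>,
  \<open>-q/s\<close> give one half each of \<open>(u;q)\<close> and \<open>(q/u;q)\<close>;
  \<open>jtheta u (q^2)\<close> supplies the other halves. The completed products pair with those of
  \<open>-u\<close>.\<close>

lemma jtheta_product:
  assumes "u \<noteq> 0" "s\<^sup>2 = u * q"
  shows "jtheta s q * jtheta (- s) q * jtheta (- u) q * jtheta u (q\<^sup>2) =
           jtheta (u\<^sup>2) (q\<^sup>2) * qpoch_inf q q ^ 3"
proof -
  have "(q / s)\<^sup>2 = q / u"
    using assms by (simp add: power_divide) (simp add: power2_eq_square)
  hence 1: "qpoch_inf (q / s) q * qpoch_inf (q / (- s)) q = qpoch_inf (q / u) (q\<^sup>2)"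
    using qpoch_inf_mult_minus[of "q / s"] by simp
  have 2: "qpoch_inf s q * qpoch_inf (- s) q = qpoch_inf (u * q) (q\<^sup>2)"
    using qpoch_inf_mult_minus[of s] assms by simp
  have 3: "qpoch_inf u q * qpoch_inf (- u) q = qpoch_inf (u\<^sup>2) (q\<^sup>2)"
    by (rule qpoch_inf_mult_minus)
  have 4: "qpoch_inf (q / u) q * qpoch_inf (q / (- u)) q = qpoch_inf (q\<^sup>2 / u\<^sup>2) (q\<^sup>2)"
    using qpoch_inf_mult_minus[of "q / u"] by (simp add: power_divide)
  have 5: "qpoch_inf u q = qpoch_inf u (q\<^sup>2) * qpoch_inf (u * q) (q\<^sup>2)"
    by (rule qpoch_inf_even_odd)
  have 6: "qpoch_inf (q / u) q = qpoch_inf (q / u) (q\<^sup>2) * qpoch_inf (q\<^sup>2 / u) (q\<^sup>2)"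
    using qpoch_inf_even_odd[of "q / u"] by (simp add: power2_eq_square)
  define M where "M = qpoch_inf (q\<^sup>2) (q\<^sup>2) * qpoch_inf q q ^ 3"
  have "jtheta s q * jtheta (- s) q * jtheta (- u) q * jtheta u (q\<^sup>2) =
          (qpoch_inf s q * qpoch_inf (- s) q) * (qpoch_inf (q / s) q * qpoch_inf (q / (- s)) q) *
          (qpoch_inf (- u) q * qpoch_inf (q / (- u)) q) *
          (qpoch_inf u (q\<^sup>2) * qpoch_inf (q\<^sup>2 / u) (q\<^sup>2)) * M"
    unfolding jtheta_def M_def by (simp only: power3_eq_cube mult_ac)
  also have "\<dots> = (qpoch_inf u q * qpoch_inf (- u) q) *
                   (qpoch_inf (q / u) q * qpoch_inf (q / (- u)) q) * M"
    unfolding 1 2 5 6 by (simp only: mult_ac)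
  also have "\<dots> = jtheta (u\<^sup>2) (q\<^sup>2) * qpoch_inf q q ^ 3"
    unfolding 3 4 jtheta_def M_def by (simp only: mult_ac)
  finally show ?thesis .
qed

text \<open>Origin of the 1/2 and of the square of \<open>J q 4\<close> in the first equation:
  \<open>(-1;q) = 2 (-q;q)\<close> for the infinite products.\<close>

lemma jtheta_minus_1: "jtheta (- 1) q * qpoch_inf q q = 2 * qpoch_inf (q\<^sup>2) (q\<^sup>2) ^ 2"
proof -
  have 1: "qpoch_inf (- 1) q = 2 * qpoch_inf (- q) q"
    by (subst qpoch_inf_shift) simp
  have 2: "qpoch_inf q q * qpoch_inf (- q) q = qpoch_inf (q\<^sup>2) (q\<^sup>2)"
    by (rule qpoch_inf_mult_minus)
  show ?thesis
    unfolding jtheta_def 1 2[symmetric] by (simp add: power2_eq_square)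
qed

text \<open>The theta zeros are simple because \<open>psi 1\<close> is nonzero, so a zero of
  \<open>S\<close> at each of them makes the singularities of the quotient removable.\<close>

lemma holomorphic_divide_jtheta:
  assumes hol: "S holomorphic_on -{0}" and z: "z \<noteq> 0"
    and zero: "\<And>n::int. S (q powi n / z) = 0"
  obtains R where "R holomorphic_on -{0}" "\<And>x. x \<noteq> 0 \<Longrightarrow> S x = jtheta (z * x) q * R x"
proof -
  define f where "f = (\<lambda>x. S x / jtheta (z * x) q)"
  define R where "R = remove_sings f"
  have regular: "f analytic_on {p}" if p: "p \<noteq> 0" "jtheta (z * p) q \<noteq> 0" for p
  proof -
    define W where "W = -{0} \<inter> (\<lambda>x. jtheta (z * x) q) -` (-{0})"
    have "(\<lambda>x. jtheta (z * x) q) holomorphic_on -{0}"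
      using z by (intro holomorphic_intros) auto
    hence "open W"
      unfolding W_def by (intro continuous_open_preimage holomorphic_on_imp_continuous_on) auto
    moreover have "f holomorphic_on W"
      unfolding f_def using z
      by (intro holomorphic_intros holomorphic_on_subset[OF hol]) (auto simp: W_def)
    moreover have "p \<in> W" using p by (auto simp: W_def)
    ultimately show ?thesis
      by (auto simp: analytic_at)
  qed
  have singular: "\<exists>c. isolated_singularity_at f p \<and> f \<midarrow>p\<rightarrow> c"
    if p: "p \<noteq> 0" "jtheta (z * p) q = 0" for p
  proof -
    obtain n where n: "z * p = q powi n"
      using jtheta_eq_0_iff[of "z * p"] z p by auto
    have "p = q powi n / z"
      unfolding n[symmetric] using z by simp
    hence Sp: "S p = 0"
      using zero[of n] by simp
    \<comment> \<open>Obtained by solving \<open>theta\<close> for \<open>jtheta (z * x) q\<close>: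
      near \<open>p\<close> the quotient is the difference quotient of \<open>S\<close> at
      \<open>p\<close> times \<open>v\<close>, and \<open>v\<close> is holomorphic where
      \<open>psi (x / p)\<close> is nonzero.\<close>
    define v where "v = (\<lambda>x. - p * ((-1) powi n * q powi (tri n) * (x / p) powi n) / psi (x / p))"
    define V where "V = -{0} \<inter> (\<lambda>x. psi (x / p)) -` (-{0})"
    have "(\<lambda>x. psi (x / p)) holomorphic_on -{0}"
      using p by (intro holomorphic_intros) auto
    hence V: "open V"
      unfolding V_def by (intro continuous_open_preimage holomorphic_on_imp_continuous_on) auto
    have pV: "p \<in> V"
      using p by (simp add: V_def psi_1)
    have theta: "((-1) powi n * q powi (tri n) * (x / p) powi n) * jtheta (z * x) q =
                   (1 - x / p) * psi (x / p)" if "x \<noteq> 0" for x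
    proof -
      have "z * x = q powi n * (x / p)"
        unfolding n[symmetric] using p by simp
      thus ?thesis
        using jtheta_powi_mult[of "x / p" n] p that by (simp add: jtheta_psi)
    qed
    have f_eq: "f x = (S x - S p) / (x - p) * v x" if x: "x \<in> V - {p}" for x
    proof -
      have nz: "x \<noteq> 0" "psi (x / p) \<noteq> 0" "x - p \<noteq> 0" using x by (auto simp: V_def)
      define k where "k = (-1) powi n * q powi (tri n) * (x / p) powi n"
      have k: "k \<noteq> 0" using nz p by (simp add: k_def)
      have "jtheta (z * x) q = (1 - x / p) * psi (x / p) / k"
        using theta[OF nz(1)] k by (simp add: k_def field_simps)
      also have "1 - x / p = (x - p) / (- p)"
        using p by (simp add: field_simps)
      finally have "f x = S x / ((x - p) / (- p) * psi (x / p) / k)"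
        by (simp add: f_def)
      also have "\<dots> = S x / (x - p) * (- p * k / psi (x / p))"
        using nz p k by (simp add: field_simps)
      finally show ?thesis by (simp add: v_def k_def Sp)
    qed
    have v_hol: "v holomorphic_on V"
      unfolding v_def using p
      by (intro holomorphic_intros) (auto simp: V_def)
    have "(\<lambda>x. (S x - S p) / (x - p) * v x) holomorphic_on V - {p}"
      by (intro holomorphic_intros holomorphic_on_subset[OF hol] holomorphic_on_subset[OF v_hol])
         (auto simp: V_def)
    hence "f holomorphic_on V - {p}"
      by (rule holomorphic_transform) (use f_eq in auto)
    hence iso: "isolated_singularity_at f p"
      using V pV by (rule isolated_singularity_at_holomorphic)
    have "S field_differentiable at p"
      using hol p by (intro holomorphic_on_imp_differentiable_at[of S "-{0}"]) auto
    then obtain D where "(S has_field_derivative D) (at p)"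
      unfolding field_differentiable_def by blast
    hence 1: "(\<lambda>x. (S x - S p) / (x - p)) \<midarrow>p\<rightarrow> D"
      by (simp add: has_field_derivative_iff)
    have "isCont v p"
      using holomorphic_on_imp_continuous_on[OF v_hol] V pV by (simp add: continuous_on_eq_continuous_at)
    hence "(\<lambda>x. (S x - S p) / (x - p) * v x) \<midarrow>p\<rightarrow> D * v p"
      using 1 by (intro tendsto_mult) (auto simp: isCont_def)
    moreover have "eventually (\<lambda>x. (S x - S p) / (x - p) * v x = f x) (at p)"
      using eventually_at_in_open[OF V pV] by eventually_elim (use f_eq in auto)
    ultimately have "f \<midarrow>p\<rightarrow> D * v p"
      by (rule Lim_transform_eventually)
    with iso show ?thesis by blast
  qed
  have "R analytic_on {p}" if "p \<noteq> 0" for p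
  proof (cases "jtheta (z * p) q = 0")
    case True
    thus ?thesis
      unfolding R_def using singular[OF that True] remove_sings_analytic_at by blast
  next
    case False
    thus ?thesis
      unfolding R_def by (intro remove_sings_analytic_on regular that)
  qed
  hence "R analytic_on -{0}"
    by (subst analytic_on_analytic_at) auto
  hence "R holomorphic_on -{0}"
    by (rule analytic_imp_holomorphic)
  moreover have "S x = jtheta (z * x) q * R x" if x: "x \<noteq> 0" for x
  proof (cases "jtheta (z * x) q = 0")
    case True
    then obtain n where n: "z * x = q powi n"
      using jtheta_eq_0_iff[of "z * x"] z x by auto
    have "x = q powi n / z"
      unfolding n[symmetric] using z by simp
    hence "S x = 0"
      using zero[of n] by simp
    thus ?thesis using True by simp
  next
    case False
    hence "R x = f x"
      unfolding R_def using regular[OF x False] by simp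
    thus ?thesis using False by (simp add: f_def)
  qed
  ultimately show ?thesis by (rule that)
qed

lemma jtheta_nz_if_denominators_nz:
  assumes "x \<noteq> 0" "z \<noteq> 0" "\<And>r::int. 1 - q powi (r - 1) * x * z \<noteq> 0"
  shows "jtheta (z * x) q \<noteq> 0"
proof
  assume "jtheta (z * x) q = 0"
  then obtain n where "z * x = q powi n"
    using jtheta_eq_0_iff[of "z * x"] assms by auto
  hence "q powi (- n) * x * z = 1"
    by (simp add: power_int_minus field_simps)
  thus False using assms(3)[of "1 - n"] by simp
qed

text \<open>The points to avoid are countably many, while a disc is uncountable.\<close>

lemma ex_jtheta_nz:
  assumes "z0 \<noteq> 0" "z1 \<noteq> 0"
  shows "\<exists>x. x \<noteq> 0 \<and> jtheta (z0 * x) q \<noteq> 0 \<and> jtheta (z1 * x) q \<noteq> 0"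
proof -
  define Z where "Z = insert 0 (range (\<lambda>n::int. q powi n / z0) \<union> range (\<lambda>n::int. q powi n / z1))"
  have "countable Z" unfolding Z_def by auto
  moreover have "uncountable (ball (0::complex) 1)"
    by (rule uncountable_ball) simp
  ultimately have "\<not> ball 0 1 \<subseteq> Z"
    using countable_subset by blast
  then obtain x where x: "x \<notin> Z" by blast
  have x0: "x \<noteq> 0" using x by (auto simp: Z_def)
  have "z * x \<noteq> q powi n" if "z \<in> {z0, z1}" for z n
  proof
    assume "z * x = q powi n"
    hence "x = q powi n / z" using that assms by (auto simp: field_simps)
    thus False using x that by (auto simp: Z_def)
  qed
  hence "jtheta (z * x) q \<noteq> 0" if "z \<in> {z0, z1}" for z
    using jtheta_eq_0_iff[of "z * x"] that assms x0 by auto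
  thus ?thesis using x0 by auto
qed

text \<open>The difference of both sides times \<open>j(x z0) j(x z1)\<close> is the function \<open>S\<close> below. The constant makes \<open>S\<close>
  vanish at all zeros of the two theta factors, so dividing them out leaves a holomorphic \<open>T\<close> with
  \<open>T(q x) = - x T(x)\<close>.\<close>

theorem appell_m_change_z:
  assumes x: "x \<noteq> 0" and z: "z0 \<noteq> 0" "z1 \<noteq> 0"
    and jz: "jtheta z0 q \<noteq> 0" "jtheta z1 q \<noteq> 0" "jtheta (z1 / z0) q \<noteq> 0"
    and denom: "\<And>r::int. 1 - q powi (r - 1) * x * z0 \<noteq> 0" "\<And>r::int. 1 - q powi (r - 1) * x * z1 \<noteq> 0"
  shows "appell_m x q z1 - appell_m x q z0 =
           z0 * qpoch_inf q q ^ 3 * jtheta (z1 / z0) q * jtheta (z0 * z1 * x) q /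
           (jtheta z0 q * jtheta z1 q * jtheta (z0 * x) q * jtheta (z1 * x) q)"
proof -
  define P where "P = qpoch_inf q q"
  \<comment> \<open>By \<open>appell_m_Phi\<close> a pole-free form of
    \<open>j(z x) m(x,q,z)\<close>.\<close>
  define N where "N = (\<lambda>z x. - z * Phi (z * x) (z\<^sup>2 * x) / jtheta z q)"
  \<comment> \<open>Solves \<open>S (1 / z0) = 0\<close>, where \<open>jtheta (z0 * x) q\<close>
    vanishes and \<open>Phi_1\<close> evaluates \<open>N z0\<close>. By \<open>j_inv\<close> the
    same value gives a zero at \<open>1 / z1\<close>.\<close>
  define c where "c = z0 * P ^ 3 * jtheta (z1 / z0) q / (jtheta z0 q * jtheta z1 q)"
  define S where "S = (\<lambda>x. jtheta (z0 * x) q * N z1 x - jtheta (z1 * x) q * N z0 x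
                            - c * jtheta (z0 * z1 * x) q)"
  have N_hol: "N z holomorphic_on -{0}" if "z \<noteq> 0" "jtheta z q \<noteq> 0" for z
  proof -
    have "(\<lambda>x. Phi (z * x) (z\<^sup>2 * x ^ 1)) holomorphic_on -{0}"
      using that by (intro Phi_holomorphic) auto
    thus ?thesis unfolding N_def using that by (intro holomorphic_intros) auto
  qed
  have S_hol: "S holomorphic_on -{0}"
    unfolding S_def by (intro holomorphic_intros N_hol) (use z jz in auto)
  have N_q: "N z (q * x) = N z x / z - jtheta (z * x) q / (z * x)"
    if "z \<noteq> 0" "jtheta z q \<noteq> 0" "x \<noteq> 0" for x z
  proof -
    have "z\<^sup>2 * x / (z * x) = z" using that by (simp add: power2_eq_square)
    hence "z\<^sup>2 * x * Phi (z * (q * x)) (z\<^sup>2 * (q * x)) =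
             z * x * Phi (z * x) (z\<^sup>2 * x) + jtheta (z * x) q * jtheta z q"
      using Phi_q_mult[of "z * x" "z\<^sup>2 * x"] that by (simp add: mult_ac)
    hence *: "Phi (z * (q * x)) (z\<^sup>2 * (q * x)) =
             (z * x * Phi (z * x) (z\<^sup>2 * x) + jtheta (z * x) q * jtheta z q) / (z\<^sup>2 * x)"
      using that by (simp add: field_simps)
    show ?thesis
      unfolding N_def * using that by (simp add: field_simps power2_eq_square)
  qed
  have j_q: "jtheta (z * (q * x)) q = - jtheta (z * x) q / (z * x)" if "z \<noteq> 0" "x \<noteq> 0" for x z
    using jtheta_q_mult[of "z * x"] that by (simp add: mult_ac)
  \<comment> \<open>The inhomogeneous parts of \<open>N_q\<close> cancel between the two products.
    What remains transforms like \<open>j(z0 z1 x)\<close>, so it cannot yet be concluded that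
    \<open>S\<close> vanishes.\<close>
  have S_q: "S (q * x) = - S x / (z0 * z1 * x)" if "x \<noteq> 0" for x
  proof -
    have "z0 * z1 \<noteq> 0" using z by simp
    show ?thesis
      unfolding S_def N_q[OF z(1) jz(1) that] N_q[OF z(2) jz(2) that]
        j_q[OF z(1) that] j_q[OF z(2) that] j_q[OF \<open>z0 * z1 \<noteq> 0\<close> that]
      using z that by (simp add: field_simps)
  qed
  have S_orbit: "S (q powi n * p) = 0" if "p \<noteq> 0" "S p = 0" for n p
  proof -
    have step: "S (q powi (n + 1) * p) = 0 \<longleftrightarrow> S (q powi n * p) = 0" for n
      using S_q[of "q powi n * p"] that z by (simp add: power_int_add mult_ac)
    show ?thesis
    proof (induction n rule: int_induct[where k = 0])
      case (step1 i)
      thus ?case using step[of i] by simp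
    next
      case (step2 i)
      thus ?case using step[of "i - 1"] by simp
    qed (use that in auto)
  qed
  have N_inverse: "N z (1 / z) = - z * P ^ 3 / jtheta z q" if "z \<noteq> 0" for z
    using that by (simp add: N_def Phi_1 P_def)
  have j_inv: "jtheta (z0 / z1) q = - jtheta (z1 / z0) q * (z0 / z1)"
    using jtheta_inverse[of "z1 / z0"] z by simp
  have "S (1 / z0) = 0"
    unfolding S_def N_inverse[OF z(1)] c_def using z jz by (simp add: field_simps)
  hence zero0: "S (q powi n / z0) = 0" for n
    using S_orbit[of "1 / z0" n] z by simp
  have e: "z0 * (1 / z1) = z0 / z1" "z1 * (1 / z1) = 1" "z0 * z1 * (1 / z1) = z0"
    using z by simp_all
  have "S (1 / z1) = 0"
    unfolding S_def e N_inverse[OF z(2)] c_def j_inv using z jz by (simp add: field_simps)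
  hence zero1: "S (q powi n / z1) = 0" for n
    using S_orbit[of "1 / z1" n] z by simp
  obtain R where R: "R holomorphic_on -{0}" "\<And>x. x \<noteq> 0 \<Longrightarrow> S x = jtheta (z0 * x) q * R x"
    using holomorphic_divide_jtheta[OF S_hol z(1) zero0] by blast
  \<comment> \<open>The second division needs the zeros of the two theta factors to be disjoint,
    which is what \<open>jtheta (z1 / z0) q \<noteq> 0\<close> says.\<close>
  have R_zero: "R (q powi n / z1) = 0" for n
  proof -
    have "jtheta (z0 * (q powi n / z1)) q \<noteq> 0"
    proof
      assume "jtheta (z0 * (q powi n / z1)) q = 0"
      hence "jtheta (z0 / z1) q = 0"
        using jtheta_powi_mult[of "z0 / z1" n] z by (simp add: mult_ac)
      thus False using j_inv jz z by simp
    qed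
    thus ?thesis using R(2)[of "q powi n / z1"] zero1[of n] z by simp
  qed
  obtain T where T: "T holomorphic_on -{0}" "\<And>x. x \<noteq> 0 \<Longrightarrow> R x = jtheta (z1 * x) q * T x"
    using holomorphic_divide_jtheta[OF R(1) z(2) R_zero] by blast
  have S_T: "S x = jtheta (z0 * x) q * jtheta (z1 * x) q * T x" if "x \<noteq> 0" for x
    using R(2)[OF that] T(2)[OF that] by simp
  define U where "U = -{0} \<inter> (\<lambda>x. jtheta (z0 * x) q * jtheta (z1 * x) q) -` (-{0})"
  have "T x = 0"
  proof (rule quasi_periodic_eq_0[where f = T and x = x and c = "-1" and k = 1 and U = U])
    have "(\<lambda>x. jtheta (z0 * x) q * jtheta (z1 * x) q) holomorphic_on -{0}"
      using z by (intro holomorphic_intros) auto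
    thus "open U"
      unfolding U_def by (intro continuous_open_preimage holomorphic_on_imp_continuous_on) auto
    show "U \<noteq> {}"
      using ex_jtheta_nz[OF z] by (auto simp: U_def)
    show "U \<subseteq> -{0}" by (auto simp: U_def)
    fix x assume "x \<in> U"
    hence nz: "x \<noteq> 0" "jtheta (z0 * x) q \<noteq> 0" "jtheta (z1 * x) q \<noteq> 0"
      by (auto simp: U_def)
    define j0 j1 where "j0 = jtheta (z0 * x) q" and "j1 = jtheta (z1 * x) q"
    have "S (q * x) = (- j0 / (z0 * x)) * (- j1 / (z1 * x)) * T (q * x)"
      using S_T[of "q * x"] nz j_q[OF z(1) nz(1)] j_q[OF z(2) nz(1)] by (simp add: j0_def j1_def)
    moreover have "S (q * x) = - (j0 * j1 * T x) / (z0 * z1 * x)"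
      using S_q[OF nz(1)] S_T[OF nz(1)] by (simp add: j0_def j1_def)
    ultimately have "(- j0 / (z0 * x)) * (- j1 / (z1 * x)) * T (q * x) = - (j0 * j1 * T x) / (z0 * z1 * x)"
      by simp
    hence "j0 * j1 * (T (q * x) + x * T x) = 0"
      using nz z by (simp add: field_simps)
    moreover have "j0 \<noteq> 0" "j1 \<noteq> 0" using nz by (auto simp: j0_def j1_def)
    ultimately have "T (q * x) = - (x * T x)"
      by (simp add: eq_neg_iff_add_eq_0)
    thus "T (q * x) = -1 * x ^ 1 * T x" by simp
  qed (use T x in auto)
  hence "S x = 0" using S_T[OF x] by simp
  moreover have j0: "jtheta (z0 * x) q \<noteq> 0" and j1: "jtheta (z1 * x) q \<noteq> 0"
    using jtheta_nz_if_denominators_nz[OF x z(1) denom(1)]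
          jtheta_nz_if_denominators_nz[OF x z(2) denom(2)] by auto
  moreover have "N z0 x = jtheta (z0 * x) q * appell_m x q z0"
                "N z1 x = jtheta (z1 * x) q * appell_m x q z1"
    using appell_m_Phi[OF x z(1) denom(1)] appell_m_Phi[OF x z(2) denom(2)]
    by (simp_all add: N_def mult.commute)
  ultimately have "jtheta (z0 * x) q * jtheta (z1 * x) q * (appell_m x q z1 - appell_m x q z0) =
                     c * jtheta (z0 * z1 * x) q"
    by (simp add: S_def algebra_simps)
  hence "appell_m x q z1 - appell_m x q z0 =
           c * jtheta (z0 * z1 * x) q / (jtheta (z0 * x) q * jtheta (z1 * x) q)"
    using j0 j1 by (simp add: field_simps)
  thus ?thesis by (simp add: c_def P_def)
qed

end

section \<open>Specialisation to base \<open>q^2\<close> and \<open>x = -a q\<close>\<close>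

theorem theorem4p2:
  fixes q a :: complex
  assumes "0 < norm q" and "norm q < 1"
    and "a \<noteq> 0"
    and "mock_g_defined (- a * q) (q\<^sup>2)"
    and "appell_m_defined (a\<^sup>2) (q\<^sup>2) (- 1)"
    and "jtheta (a ^ 4) (q ^ 4) \<noteq> 0"
    and "appell_m_defined (a\<^sup>2) (q\<^sup>2) (- (inverse a * q))"
  shows "(\<lambda>n. q ^ (2 * n + 1) * qpoch (- a * q) (q\<^sup>2) n * qpoch (- q / a) (q\<^sup>2) n) sums
           (- q * mock_g (- a * q) (q\<^sup>2)
            + a * (jtheta (- a * q) (q\<^sup>2) / J q 2) * appell_m (a\<^sup>2) (q\<^sup>2) (- 1)
            - 1 / 2 * (a * jtheta (a * q) (q\<^sup>2) ^ 3 * jtheta (a\<^sup>2) (q ^ 4)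
                       / ((J q 4)\<^sup>2 * jtheta (a ^ 4) (q ^ 4))))
       \<and> - q * mock_g (- a * q) (q\<^sup>2)
            + a * (jtheta (- a * q) (q\<^sup>2) / J q 2) * appell_m (a\<^sup>2) (q\<^sup>2) (- 1)
            - 1 / 2 * (a * jtheta (a * q) (q\<^sup>2) ^ 3 * jtheta (a\<^sup>2) (q ^ 4)
                       / ((J q 4)\<^sup>2 * jtheta (a ^ 4) (q ^ 4)))
         = - q * mock_g (- a * q) (q\<^sup>2)
            + a * (jtheta (- a * q) (q\<^sup>2) / J q 2)
              * appell_m (a\<^sup>2) (q\<^sup>2) (- (inverse a * q))"
    (is "?lhs sums ?first \<and> _ = ?second")
proof -
  have q: "q \<noteq> 0" using assms by auto
  have a: "a \<noteq> 0" by fact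
  interpret Q: nome "q\<^sup>2"
    using assms(2) q by unfold_locales (auto simp: norm_power power_less_one_iff)
  interpret Q2: nome "(q\<^sup>2)\<^sup>2"
    by (rule Q.nome_square)
  define x z where "x = - a * q" and "z = - (inverse a * q)"
  define P where "P = qpoch_inf (q\<^sup>2) (q\<^sup>2)"
  have q4: "q ^ 4 = (q\<^sup>2)\<^sup>2" and a4: "a ^ 4 = (a\<^sup>2)\<^sup>2"
    by simp_all
  have P: "P \<noteq> 0" "J q 2 = P"
    by (simp_all add: P_def J_def)
  have J4: "J q 4 = qpoch_inf ((q\<^sup>2)\<^sup>2) ((q\<^sup>2)\<^sup>2)"
    by (simp add: J_def)
  have J4_nz: "J q 4 \<noteq> 0"
    unfolding J4 by (rule Q2.qpoch_inf_q_nz)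
  have nz: "x \<noteq> 0" "z \<noteq> 0" using a q by (auto simp: x_def z_def)
  have xz: "q\<^sup>2 / x = z" "a\<^sup>2 * z = x" "z\<^sup>2 * a\<^sup>2 = q\<^sup>2" "a * z = - q" "- q / a = z"
    using a q by (simp_all add: x_def z_def field_simps power2_eq_square)
  have m1: "\<And>r::int. 1 - (q\<^sup>2) powi (r - 1) * a\<^sup>2 * (- 1) \<noteq> 0" "jtheta (- 1) (q\<^sup>2) \<noteq> 0"
    using assms(5) by (auto simp: appell_m_defined_def)
  have m2: "\<And>r::int. 1 - (q\<^sup>2) powi (r - 1) * a\<^sup>2 * z \<noteq> 0" "jtheta z (q\<^sup>2) \<noteq> 0"
    using assms(7) by (auto simp: appell_m_defined_def z_def)
  have jz: "jtheta z (q\<^sup>2) = jtheta x (q\<^sup>2)"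
    using Q.jtheta_q_divide[OF nz(1)] xz by simp
  have jx: "jtheta x (q\<^sup>2) \<noteq> 0" using m2 jz by simp

  have "appell_m (a\<^sup>2) (q\<^sup>2) z * jtheta x (q\<^sup>2) = - z * Q.Phi x (q\<^sup>2) / jtheta x (q\<^sup>2)"
    using Q.appell_m_Phi[OF _ nz(2) m2(1)] a unfolding xz jz by (simp add: mult.commute)
  hence "a * (jtheta x (q\<^sup>2) / P) * appell_m (a\<^sup>2) (q\<^sup>2) z = - (a * z) * Q.Phi x (q\<^sup>2) / (jtheta x (q\<^sup>2) * P)"
    using jx P by (simp add: field_simps)
  also have "\<dots> = q * (Q.F_sum x + Q.G_sum x)"
    unfolding Q.F_plus_G[OF nz(1) jx] xz(4) by (simp add: P_def)
  finally have "q * Q.F_sum x = ?second"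
    unfolding P x_def[symmetric] z_def[symmetric] Q.mock_g_eq_G_sum[OF nz(1) jx]
    by (simp add: algebra_simps)
  moreover have "(\<lambda>n. q * Q.F_term x n) sums (q * Q.F_sum x)"
    by (intro sums_mult Q.F_sums)
  moreover have "(\<lambda>n. q * Q.F_term x n) = ?lhs"
    unfolding Q.F_term_def xz x_def[symmetric] power_add power_mult power_one_right
    by (simp only: mult_ac)
  ultimately have sums: "?lhs sums ?second" by simp

  \<comment> \<open>Base \<open>q^2\<close>, \<open>u = a^2\<close>, \<open>s = a q\<close>. This
    introduces the thetas of base \<open>q^4\<close> in place of \<open>j(-a^2;q^2)\<close>, and the
    hypothesis on \<open>j(a^4;q^4)\<close> makes all factors on the left nonzero.\<close>
  have prod: "jtheta (a * q) (q\<^sup>2) * jtheta x (q\<^sup>2) * jtheta (- a\<^sup>2) (q\<^sup>2) * jtheta (a\<^sup>2) (q ^ 4) =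
                jtheta (a ^ 4) (q ^ 4) * P ^ 3"
    using Q.jtheta_product[of "a\<^sup>2" "a * q"] a unfolding q4 a4 P_def x_def
    by (simp add: power_mult_distrib)
  hence pnz: "jtheta (a * q) (q\<^sup>2) \<noteq> 0" "jtheta (- a\<^sup>2) (q\<^sup>2) \<noteq> 0" "jtheta (a\<^sup>2) (q ^ 4) \<noteq> 0"
    using assms(6) P by auto
  have jm1: "jtheta (- 1) (q\<^sup>2) = 2 * (J q 4)\<^sup>2 / P"
    using Q.jtheta_minus_1 P(1) unfolding J4 P_def by (simp add: field_simps)
  \<comment> \<open>The change of \<open>z\<close> involves \<open>z1 / z0 = -1 / z = a / q\<close>;
    the factor \<open>-a/q\<close> of the shift to \<open>a q\<close> cancels against
    \<open>z\<close>.\<close>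
  have aq: "jtheta (a / q) (q\<^sup>2) = - (a / q) * jtheta (a * q) (q\<^sup>2)"
  proof -
    have "q\<^sup>2 * (a / q) = a * q" using q by (simp add: power2_eq_square)
    thus ?thesis using Q.jtheta_q_mult[of "a / q"] a q by simp
  qed
  have zz: "- 1 / z = a / q" "z * (- 1) * a\<^sup>2 = a * q" "z * a\<^sup>2 = x" "- 1 * a\<^sup>2 = - a\<^sup>2"
    using a q by (simp_all add: z_def x_def field_simps power2_eq_square)
  have "appell_m (a\<^sup>2) (q\<^sup>2) (- 1) - appell_m (a\<^sup>2) (q\<^sup>2) z =
          z * P ^ 3 * jtheta (a / q) (q\<^sup>2) * jtheta (a * q) (q\<^sup>2) /
          (jtheta x (q\<^sup>2) * jtheta (- 1) (q\<^sup>2) * jtheta x (q\<^sup>2) * jtheta (- a\<^sup>2) (q\<^sup>2))"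
  proof -
    have 1: "a\<^sup>2 \<noteq> 0" "- 1 \<noteq> (0 :: complex)" using a by auto
    have 2: "jtheta (- 1 / z) (q\<^sup>2) \<noteq> 0"
      unfolding zz aq using pnz a q by simp
    show ?thesis
      using Q.appell_m_change_z[OF 1(1) nz(2) 1(2) m2(2) m1(2) 2 m2(1) m1(1)]
      unfolding zz jz P_def .
  qed
  also have "\<dots> = P ^ 4 * jtheta (a * q) (q\<^sup>2) ^ 2 /
                  (2 * jtheta x (q\<^sup>2) ^ 2 * (J q 4)\<^sup>2 * jtheta (- a\<^sup>2) (q\<^sup>2))"
  proof -
    have "z * (- (a / q)) = 1" using a q by (simp add: z_def)
    hence "z * P ^ 3 * jtheta (a / q) (q\<^sup>2) * jtheta (a * q) (q\<^sup>2) = P ^ 3 * jtheta (a * q) (q\<^sup>2) ^ 2"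
      unfolding aq by algebra
    thus ?thesis
      unfolding jm1 using P by (simp add: power2_eq_square power_numeral_reduce mult_ac)
  qed
  finally have diff: "appell_m (a\<^sup>2) (q\<^sup>2) (- 1) - appell_m (a\<^sup>2) (q\<^sup>2) z = \<dots>" .
  \<comment> \<open>Of \<open>P^4\<close>, one factor cancels against \<open>J q 2\<close> and three
    are absorbed by \<open>prod\<close>.\<close>
  have "a * (jtheta x (q\<^sup>2) / P) * (appell_m (a\<^sup>2) (q\<^sup>2) (- 1) - appell_m (a\<^sup>2) (q\<^sup>2) z) =
          1 / 2 * (a * jtheta (a * q) (q\<^sup>2) ^ 3 * jtheta (a\<^sup>2) (q ^ 4) / ((J q 4)\<^sup>2 * jtheta (a ^ 4) (q ^ 4)))"
  proof -
    have "jtheta (a ^ 4) (q ^ 4) =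
            jtheta (a * q) (q\<^sup>2) * jtheta x (q\<^sup>2) * jtheta (- a\<^sup>2) (q\<^sup>2) * jtheta (a\<^sup>2) (q ^ 4) / P ^ 3"
      using prod P by (simp add: field_simps)
    thus ?thesis
      unfolding diff using P J4_nz pnz jx
      by (simp add: power2_eq_square power3_eq_cube power_numeral_reduce mult_ac)
  qed
  hence eq: "?first = ?second"
    unfolding P(2) x_def[symmetric] z_def[symmetric] by (simp add: algebra_simps)
  have "?lhs sums ?first"
    unfolding eq by (rule sums)
  thus ?thesis
    using eq by (rule conjI)
qed

end
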